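(* Let $1\le i\le n$ and $m\ge 1$, and let $\mathrm{pr}:B^{i,m}\to B^{i,m}$ be the promotion operator on the polytope $B^{i,m}$. Then the affine Kashiwara operators $\tilde f_0:=\mathrm{pr}^{-1}\circ\tilde f_1\circ\mathrm{pr}$ and $\tilde e_0:=\mathrm{pr}^{-1}\circ\tilde e_1\circ\mathrm{pr}$ (i.e. those for which $B^{i,m}$ is isomorphic to the Kirillov--Reshetikhin crystal of type $A_n^{(1)}$) satisfy $$\tilde f_0=\mathrm{pr}^{-1}\circ\tilde f_1\circ\mathrm{pr}=f_0,\qquad \tilde e_0=\mathrm{pr}^{-1}\circ\tilde e_1\circ\mathrm{pr}=e_0,$$ where $f_0$ and $e_0$ are the explicit operators on $B^{i,m}$ given as follows. Put $\varphi_0(A)=a_{1,n}$ and $\epsilon_0(A)=m-\sum_{j=i}^n a_{1,j}-\sum_{j=2}^i a_{j,n}$. Then $f_0A=0$ if $\varphi_0(A)=0$, and otherwise $f_0A$ is obtained from $A$ by replacing $a_{1,n}$ by $a_{1,n}-1$; and $e_0A=0$ if $\epsilon_0(A)=0$, and otherwise $e_0A$ is obtained from $A$ by replacing $a_{1,n}$ by $a_{1,n}+1$.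
   Context: Let $n\ge 1$, $I_0=\{1,\dots,n\}$; let $\alpha_l,\omega_l$ ($l\in I_0$) be the simple roots and fundamental weights of type $A_n$ and $\alpha_{p,q}=\alpha_p+\alpha_{p+1}+\cdots+\alpha_q$ for $1\le p\le q\le n$. The polytope $B^{i,m}$. It is the set of arrays $A=(a_{p,q})_{1\le p\le i,\ i\le q\le n}$ of non-negative integers ($p$ is the column index, $q$ the row index) such that $\sum_{s=1}^n a_{\beta(s)}\le m$ for every sequence $(\beta(1),\dots,\beta(n))$ with $\beta(1)=(1,i)$, $\beta(n)=(i,n)$ and such that $\beta(s)=(p,q)$ implies $\beta(s+1)\in\{(p,q+1),(p+1,q)\}$. The weight is $\mathrm{wt}(A)=m\omega_i-\sum_{1\le p\le i\le q\le n}a_{p,q}\alpha_{p,q}$. Classical crystal structure. For $l>i$ let $F_l(p)=\sum_{j=1}^p a_{j,l-1}+\sum_{j=p}^i a_{j,l}$ ($1\le p\le i$), and let $p^l_+(A)$ (resp. $q^l_+(A)$) be the smallest (resp. largest) $p$ at which $F_l$ attains its maximum. For $l<i$ let $G_l(p)=\sum_{j=i}^p a_{l,j}+\sum_{j=p}^n a_{l+1,j}$ ($i\le p\le n$), and let $p^l_-(A)$ (resp. $q^l_-(A)$) be the largest (resp. smallest) $p$ at which $G_l$ attains its maximum. Set $\varphi_i(A)=m-\sum_{j=1}^{i-1}a_{j,i}-\sum_{j=i}^n a_{i,j}$; $\varphi_l(A)=\sum_{j=1}^{p^l_+(A)}a_{j,l-1}-\sum_{j=1}^{p^l_+(A)-1}a_{j,l}$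 for $l>i$; $\varphi_l(A)=\sum_{j=p^l_-(A)}^n a_{l+1,j}-\sum_{j=p^l_-(A)+1}^n a_{l,j}$ for $l<i$; $\epsilon_i(A)=a_{i,i}$; $\epsilon_l(A)=\sum_{j=q^l_+(A)}^i a_{j,l}-\sum_{j=q^l_+(A)+1}^i a_{j,l-1}$ for $l>i$; $\epsilon_l(A)=\sum_{j=i}^{q^l_-(A)}a_{l,j}-\sum_{j=i}^{q^l_-(A)-1}a_{l+1,j}$ for $l<i$. For $l\in I_0$, $\tilde f_lA=0$ if $\varphi_l(A)=0$, and otherwise $\tilde f_l$ acts by: $l=i$: $a_{i,i}\mapsto a_{i,i}+1$; $l>i$: with $p=p^l_+(A)$, $a_{p,l-1}\mapsto a_{p,l-1}-1$ and $a_{p,l}\mapsto a_{p,l}+1$; $l<i$: with $p=p^l_-(A)$, $a_{l,p}\mapsto a_{l,p}+1$ and $a_{l+1,p}\mapsto a_{l+1,p}-1$. Likewise $\tilde e_lA=0$ if $\epsilon_l(A)=0$, and otherwise: $l=i$: $a_{i,i}\mapsto a_{i,i}-1$; $l>i$: with $q=q^l_+(A)$, $a_{q,l-1}\mapsto a_{q,l-1}+1$ and $a_{q,l}\mapsto a_{q,l}-1$; $l<i$: with $q=q^l_-(A)$, $a_{l,q}\mapsto a_{l,q}-1$ and $a_{l+1,q}\mapsto a_{l+1,q}+1$. The promotion operator. $\mathrm{pr}$ is the analogue on $B^{i,m}$ of the Dynkin diagram automorphism $l\mapsto l+1 \bmod (n+1)$. It is the unique bijection $\mathrm{pr}:B^{i,m}\to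 B^{i,m}$ such that (with $\mathrm{pr}(0)=0$): (1) $\mathrm{pr}\circ\tilde f_l=\tilde f_{l+1}\circ\mathrm{pr}$ and $\mathrm{pr}\circ\tilde e_l=\tilde e_{l+1}\circ\mathrm{pr}$ for $1\le l\le n-1$; and (2) $\mathrm{pr}$ rotates the content: if $A$ has content $(w_1,\dots,w_{n+1})$ then $\mathrm{pr}(A)$ has content $(w_{n+1},w_1,\dots,w_n)$, where the content of $A$ is $w_j=m-\sum_{q=i}^n a_{j,q}$ for $1\le j\le i$ and $w_j=\sum_{p=1}^i a_{p,j-1}$ for $i+1\le j\le n+1$. It is a known result that $B^{i,m}$ with the classical crystal structure consisting of the weight function $\mathrm{wt}$, the maps $\varphi_l,\epsilon_l$ and the operators $\tilde f_l,\tilde e_l$ for $l\in I_0$, and with the operators $\mathrm{pr}^{-1}\circ\tilde f_1\circ\mathrm{pr}$, $\mathrm{pr}^{-1}\circ\tilde e_1\circ\mathrm{pr}$ as $\tilde f_0$, $\tilde e_0$, is isomorphic to the Kirillov--Reshetikhin crystal of type $A_n^{(1)}$. *)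

theory Defs
  imports Main
begin

text \<open>
  Parameters throughout: the rank \<open>n\<close>, the node \<open>i\<close> with \<open>1 \<le> i \<le> n\<close>, and \<open>m\<close>.
  An array has entry \<open>A p q\<close> in column \<open>p\<close> and row \<open>q\<close>. Entries outside the index range
  \<open>1 \<le> p \<le> i \<le> q \<le> n\<close> are required to be 0 in \<open>polytope\<close> below, so that arrays are equal
  iff their entries in the index range are. Entries are integers (with non-negativity imposed
  in \<open>polytope\<close>), so that no subtraction is truncated.
\<close>

type_synonym array = "nat \<Rightarrow> nat \<Rightarrow> int"

definition lattice_path :: "nat \<Rightarrow> nat \<Rightarrow> (nat \<Rightarrow> nat \<times> nat) \<Rightarrow> bool" where
  "lattice_path n i \<beta> \<longleftrightarrow> \<beta> 1 = (1, i) \<and> \<beta> n = (i, n) \<and>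
     (\<forall>s\<in>{1..<n}. \<forall>p q. \<beta> s = (p, q) \<longrightarrow> \<beta> (s + 1) \<in> {(p, q + 1), (p + 1, q)})"

definition polytope :: "nat \<Rightarrow> nat \<Rightarrow> nat \<Rightarrow> array set" where
  "polytope n i m = {A.
     (\<forall>p q. A p q \<ge> 0) \<and>
     (\<forall>p q. (p, q) \<notin> {1..i} \<times> {i..n} \<longrightarrow> A p q = 0) \<and>
     (\<forall>\<beta>. lattice_path n i \<beta> \<longrightarrow> (\<Sum>s=1..n. case \<beta> s of (p, q) \<Rightarrow> A p q) \<le> int m)}"

definition maximizers :: "(nat \<Rightarrow> int) \<Rightarrow> nat set \<Rightarrow> nat set" where
  "maximizers g S = {p\<in>S. \<forall>p'\<in>S. g p' \<le> g p}"

definition F :: "nat \<Rightarrow> nat \<Rightarrow> array \<Rightarrow> nat \<Rightarrow> int" where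
  "F i l A p = (\<Sum>j=1..p. A j (l - 1)) + (\<Sum>j=p..i. A j l)"

definition G :: "nat \<Rightarrow> nat \<Rightarrow> nat \<Rightarrow> array \<Rightarrow> nat \<Rightarrow> int" where
  "G n i l A p = (\<Sum>j=i..p. A l j) + (\<Sum>j=p..n. A (l + 1) j)"

definition p_plus :: "nat \<Rightarrow> nat \<Rightarrow> array \<Rightarrow> nat" where
  "p_plus i l A = Min (maximizers (F i l A) {1..i})"

definition q_plus :: "nat \<Rightarrow> nat \<Rightarrow> array \<Rightarrow> nat" where
  "q_plus i l A = Max (maximizers (F i l A) {1..i})"

definition p_minus :: "nat \<Rightarrow> nat \<Rightarrow> nat \<Rightarrow> array \<Rightarrow> nat" where
  "p_minus n i l A = Max (maximizers (G n i l A) {i..n})"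

definition q_minus :: "nat \<Rightarrow> nat \<Rightarrow> nat \<Rightarrow> array \<Rightarrow> nat" where
  "q_minus n i l A = Min (maximizers (G n i l A) {i..n})"

definition phi :: "nat \<Rightarrow> nat \<Rightarrow> nat \<Rightarrow> nat \<Rightarrow> array \<Rightarrow> int" where
  "phi n i m l A =
     (if l = i then int m - (\<Sum>j\<in>{1..<i}. A j i) - (\<Sum>j=i..n. A i j)
      else if l > i then
        (\<Sum>j=1..p_plus i l A. A j (l - 1)) - (\<Sum>j\<in>{1..<p_plus i l A}. A j l)
      else
        (\<Sum>j=p_minus n i l A..n. A (l + 1) j) - (\<Sum>j=p_minus n i l A + 1..n. A l j))"

definition eps :: "nat \<Rightarrow> nat \<Rightarrow> nat \<Rightarrow> array \<Rightarrow> int" where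
  "eps n i l A =
     (if l = i then A i i
      else if l > i then
        (\<Sum>j=q_plus i l A..i. A j l) - (\<Sum>j=q_plus i l A + 1..i. A j (l - 1))
      else
        (\<Sum>j=i..q_minus n i l A. A l j) - (\<Sum>j\<in>{i..<q_minus n i l A}. A (l + 1) j))"

definition add_entry :: "nat \<Rightarrow> nat \<Rightarrow> int \<Rightarrow> array \<Rightarrow> array" where
  "add_entry p q d A = A(p := (A p)(q := A p q + d))"

text \<open>
  In the crystal operators \<open>None\<close> stands for the extra element 0. The classical operators
  are meant for \<open>1 \<le> l \<le> n\<close> only.
\<close>

definition f_op :: "nat \<Rightarrow> nat \<Rightarrow> nat \<Rightarrow> nat \<Rightarrow> array \<Rightarrow> array option" where
  "f_op n i m l A =
     (if phi n i m l A = 0 then None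
      else if l = i then Some (add_entry i i 1 A)
      else if l > i then
        (let p = p_plus i l A in Some (add_entry p (l - 1) (- 1) (add_entry p l 1 A)))
      else
        (let p = p_minus n i l A in Some (add_entry l p 1 (add_entry (l + 1) p (- 1) A))))"

definition e_op :: "nat \<Rightarrow> nat \<Rightarrow> nat \<Rightarrow> array \<Rightarrow> array option" where
  "e_op n i l A =
     (if eps n i l A = 0 then None
      else if l = i then Some (add_entry i i (- 1) A)
      else if l > i then
        (let q = q_plus i l A in Some (add_entry q (l - 1) 1 (add_entry q l (- 1) A)))
      else
        (let q = q_minus n i l A in Some (add_entry l q (- 1) (add_entry (l + 1) q 1 A))))"

definition content :: "nat \<Rightarrow> nat \<Rightarrow> nat \<Rightarrow> array \<Rightarrow> nat \<Rightarrow> int" where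
  "content n i m A j =
     (if j \<le> i then int m - (\<Sum>q=i..n. A j q) else (\<Sum>p=1..i. A p (j - 1)))"

text \<open>
  The defining properties of the promotion operator, which determine \<open>pr\<close> uniquely on the
  polytope; values of \<open>pr\<close> elsewhere are irrelevant. The convention \<open>pr 0 = 0\<close> is the use of
  \<^const>\<open>map_option\<close>.
\<close>

definition is_promotion :: "nat \<Rightarrow> nat \<Rightarrow> nat \<Rightarrow> (array \<Rightarrow> array) \<Rightarrow> bool" where
  "is_promotion n i m pr \<longleftrightarrow>
     bij_betw pr (polytope n i m) (polytope n i m) \<and>
     (\<forall>A\<in>polytope n i m. \<forall>l. 1 \<le> l \<and> l + 1 \<le> n \<longrightarrow>
        map_option pr (f_op n i m l A) = f_op n i m (l + 1) (pr A) \<and>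
        map_option pr (e_op n i l A) = e_op n i (l + 1) (pr A)) \<and>
     (\<forall>A\<in>polytope n i m.
        content n i m (pr A) 1 = content n i m A (n + 1) \<and>
        (\<forall>j\<in>{1..n}. content n i m (pr A) (j + 1) = content n i m A j))"

definition affine_f0 :: "nat \<Rightarrow> nat \<Rightarrow> nat \<Rightarrow> (array \<Rightarrow> array) \<Rightarrow> array \<Rightarrow> array option" where
  "affine_f0 n i m pr = map_option (inv_into (polytope n i m) pr) \<circ> f_op n i m 1 \<circ> pr"

definition affine_e0 :: "nat \<Rightarrow> nat \<Rightarrow> nat \<Rightarrow> (array \<Rightarrow> array) \<Rightarrow> array \<Rightarrow> array option" where
  "affine_e0 n i m pr = map_option (inv_into (polytope n i m) pr) \<circ> e_op n i 1 \<circ> pr"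

definition phi0 :: "nat \<Rightarrow> array \<Rightarrow> int" where
  "phi0 n A = A 1 n"

definition eps0 :: "nat \<Rightarrow> nat \<Rightarrow> nat \<Rightarrow> array \<Rightarrow> int" where
  "eps0 n i m A = int m - (\<Sum>j=i..n. A 1 j) - (\<Sum>j=2..i. A j n)"

definition f0 :: "nat \<Rightarrow> array \<Rightarrow> array option" where
  "f0 n A = (if phi0 n A = 0 then None else Some (add_entry 1 n (- 1) A))"

definition e0 :: "nat \<Rightarrow> nat \<Rightarrow> nat \<Rightarrow> array \<Rightarrow> array option" where
  "e0 n i m A = (if eps0 n i m A = 0 then None else Some (add_entry 1 n 1 A))"

end

theory Submission
  imports Defs
begin

text \<open>
  Why the theorem holds. Put \<open>B = pr A\<close>. The assertion about \<open>f\<^sub>0\<close> is that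
  \<open>f\<^sub>1 B\<close> is the image under \<open>pr\<close> of \<open>f\<^sub>0 A\<close> (\<open>promotion_f0\<close>). It is reduced to
  arrays on which the axioms for \<open>pr\<close> can be exploited by hand.

  Take \<open>2 \<le> l < n\<close>. The operators \<open>e\<^sub>l\<close> and \<open>f\<^sub>l\<close> neither read nor write the corner entry
  \<open>a\<^bsub>1,n\<^esub>\<close>, so they commute with the explicit \<open>f\<^sub>0\<close>. On the other side \<open>f\<^sub>1\<close> commutes with
  \<open>f\<^bsub>l+1\<^esub>\<close> (\<open>f_op_1_commute\<close>), as the nodes 1 and \<open>l + 1\<close> are not adjacent, and \<open>pr\<close>
  carries \<open>e\<^sub>l\<close>, \<open>f\<^sub>l\<close> to \<open>e\<^bsub>l+1\<^esub>\<close>, \<open>f\<^bsub>l+1\<^esub>\<close>. So if \<open>A = f\<^sub>l A'\<close>, the claim for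
  \<open>A'\<close> implies the claim for \<open>A\<close>. Applying such \<open>e\<^sub>l\<close> as long as possible, one is left
  with the arrays \<open>A\<close> that are killed by every \<open>e\<^sub>l\<close> with \<open>2 \<le> l < n\<close>; then \<open>B\<close> is
  killed by every \<open>e\<^sub>l\<close> with \<open>3 \<le> l \<le> n\<close>.

  Both kinds of highest weight arrays form families of at most three parameters. The first kind
  lives on the cells \<open>(1,i)\<close>, \<open>(1,n)\<close>, \<open>(i,n)\<close>, and the second kind on
  \<open>(1,i)\<close>, \<open>(2,i)\<close>, \<open>(1,i+1)\<close>. This reflects that the representation of
  highest weight \<open>m\<omega>\<^sub>i\<close> is multiplicity free when restricted to \<open>GL\<^bsub>n-1\<^esub>\<close> times the
  torus of the two remaining coordinates; in particular an array of the second kind is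
  determined by its content. There \<open>f\<^sub>1\<close> is explicit, the rotation of the content shows
  that \<open>f\<^sub>1 B = 0\<close> exactly if
  \<open>a\<^bsub>1,n\<^esub> = 0\<close>, and otherwise \<open>f\<^sub>1 B\<close> and \<open>pr (f\<^sub>0 A)\<close> agree, being on the same
  three cells and having the same content (\<open>promotion_f0_highest_weight\<close>).

  The induction must stay inside the polytope, which is the combinatorial core of
  \<open>e_op_polytope\<close>: a lattice path that would become too heavy can be rerouted, one corner at
  a time, into a path that is already heavier than it.

  The assertion about \<open>e\<^sub>0\<close> follows because \<open>e\<^sub>0\<close> inverts \<open>f\<^sub>0\<close> in the same way as
  \<open>e\<^sub>1\<close> inverts \<open>f\<^sub>1\<close>. The path along row \<open>n\<close> and column 1 is the only one through the
  cell \<open>(1,n)\<close>, and \<open>\<epsilon>\<^sub>0(A)\<close> is its slack; so \<open>a\<^bsub>1,n\<^esub>\<close> can be increased exactly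
  if \<open>\<epsilon>\<^sub>0(A)\<close> is positive.
\<close>

section \<open>First and last maximizers\<close>

definition first_max :: "(nat \<Rightarrow> int) \<Rightarrow> nat set \<Rightarrow> nat \<Rightarrow> bool" where
  "first_max g S p \<longleftrightarrow> p \<in> S \<and> (\<forall>t\<in>S. g t \<le> g p) \<and> (\<forall>t\<in>S. t < p \<longrightarrow> g t < g p)"

definition last_max :: "(nat \<Rightarrow> int) \<Rightarrow> nat set \<Rightarrow> nat \<Rightarrow> bool" where
  "last_max g S p \<longleftrightarrow> p \<in> S \<and> (\<forall>t\<in>S. g t \<le> g p) \<and> (\<forall>t\<in>S. p < t \<longrightarrow> g t < g p)"

lemma maximizers_nonempty:
  assumes "finite S" "S \<noteq> {}"
  shows "maximizers g S \<noteq> {}"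
proof -
  have "Max (g ` S) \<in> g ` S" using assms by simp
  then obtain p where "p \<in> S" "g p = Max (g ` S)" by force
  then show ?thesis using assms by (auto simp: maximizers_def)
qed

lemma Min_maximizers_eq:
  assumes "finite S" "first_max g S p"
  shows "Min (maximizers g S) = p"
proof (rule Min_eqI)
  show "finite (maximizers g S)" using assms(1) by (simp add: maximizers_def)
  show "p \<in> maximizers g S" using assms(2) by (auto simp: maximizers_def first_max_def)
  show "p \<le> t" if "t \<in> maximizers g S" for t
    using that assms(2) by (fastforce simp: maximizers_def first_max_def not_less[symmetric])
qed

lemma Max_maximizers_eq:
  assumes "finite S" "last_max g S p"
  shows "Max (maximizers g S) = p"
proof (rule Max_eqI)
  show "finite (maximizers g S)" using assms(1) by (simp add: maximizers_def)
  show "p \<in> maximizers g S" using assms(2) by (auto simp: maximizers_def last_max_def)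
  show "t \<le> p" if "t \<in> maximizers g S" for t
    using that assms(2) by (fastforce simp: maximizers_def last_max_def not_less[symmetric])
qed

lemma first_max_exists:
  assumes "finite S" "S \<noteq> {}"
  obtains p where "first_max g S p"
proof
  let ?M = "maximizers g S"
  have fin: "finite ?M" using assms(1) by (simp add: maximizers_def)
  have mem: "Min ?M \<in> ?M" using fin maximizers_nonempty[OF assms] by simp
  have "g t < g (Min ?M)" if "t \<in> S" "t < Min ?M" for t
  proof (rule ccontr)
    assume "\<not> g t < g (Min ?M)"
    then have "t \<in> ?M" using mem that(1) by (fastforce simp: maximizers_def)
    then show False using Min_le[OF fin, of t] that(2) by simp
  qed
  with mem show "first_max g S (Min ?M)"
    by (auto simp: first_max_def maximizers_def)
qed

lemma last_max_exists:
  assumes "finite S" "S \<noteq> {}"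
  obtains p where "last_max g S p"
proof
  let ?M = "maximizers g S"
  have fin: "finite ?M" using assms(1) by (simp add: maximizers_def)
  have mem: "Max ?M \<in> ?M" using fin maximizers_nonempty[OF assms] by simp
  have "g t < g (Max ?M)" if "t \<in> S" "Max ?M < t" for t
  proof (rule ccontr)
    assume "\<not> g t < g (Max ?M)"
    then have "t \<in> ?M" using mem that(1) by (fastforce simp: maximizers_def)
    then show False using Max_ge[OF fin, of t] that(2) by simp
  qed
  with mem show "last_max g S (Max ?M)"
    by (auto simp: last_max_def maximizers_def)
qed

section \<open>Changing a single entry\<close>

lemma add_entry_apply:
  "add_entry p q d A p' q' = A p' q' + (if p' = p \<and> q' = q then d else 0)"
  by (auto simp: add_entry_def)

lemma add_entry_commute:
  "add_entry p q d (add_entry p' q' d' A) = add_entry p' q' d' (add_entry p q d A)"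
  by (intro ext) (simp add: add_entry_apply)

lemma add_entry_cancel:
  "d + d' = 0 \<Longrightarrow> add_entry p q d (add_entry p q d' A) = A"
  by (intro ext) (simp add: add_entry_apply)

lemma row_sum_add_entry:
  "finite S \<Longrightarrow> (\<Sum>j\<in>S. add_entry p q d A j q')
     = (\<Sum>j\<in>S. A j q') + (if q' = q \<and> p \<in> S then d else 0)"
  by (cases "q' = q") (simp_all add: add_entry_apply sum.distrib)

lemma column_sum_add_entry:
  "finite S \<Longrightarrow> (\<Sum>j\<in>S. add_entry p q d A p' j)
     = (\<Sum>j\<in>S. A p' j) + (if p' = p \<and> q \<in> S then d else 0)"
  by (cases "p' = p") (simp_all add: add_entry_apply sum.distrib)

lemma F_add_entry:
  "F i l (add_entry p q d A) t = F i l A t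
     + (if q = l - 1 \<and> p \<in> {1..t} then d else 0) + (if q = l \<and> p \<in> {t..i} then d else 0)"
  by (auto simp: F_def row_sum_add_entry)

lemma G_add_entry:
  "G n i l (add_entry p q d A) t = G n i l A t
     + (if p = l \<and> q \<in> {i..t} then d else 0) + (if p = l + 1 \<and> q \<in> {t..n} then d else 0)"
  by (auto simp: G_def column_sum_add_entry)

lemma F_Suc:
  assumes "Suc t \<le> i"
  shows "F i l A (Suc t) = F i l A t + A (Suc t) (l - 1) - A t l"
proof -
  have "(\<Sum>j=t..i. A j l) = A t l + (\<Sum>j=Suc t..i. A j l)"
    using assms by (intro sum.atLeast_Suc_atMost) simp
  then show ?thesis by (simp add: F_def)
qed

lemma G_Suc:
  assumes "i \<le> Suc t" "Suc t \<le> n"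
  shows "G n i l A (Suc t) = G n i l A t + A l (Suc t) - A (l + 1) t"
proof -
  have "(\<Sum>j=t..n. A (l + 1) j) = A (l + 1) t + (\<Sum>j=Suc t..n. A (l + 1) j)"
    using assms by (intro sum.atLeast_Suc_atMost) simp
  then show ?thesis using assms by (simp add: G_def)
qed

section \<open>Crystal operators through extreme maximizers\<close>

lemma sum_split_at:
  fixes x :: "nat \<Rightarrow> int"
  assumes "a \<le> p" "p \<le> b"
  shows "(\<Sum>j=a..b. x j) = (\<Sum>j\<in>{a..<p}. x j) + (\<Sum>j=p..b. x j)"
    and "(\<Sum>j=a..b. x j) = (\<Sum>j=a..p. x j) + (\<Sum>j=p + 1..b. x j)"
proof -
  have "{a..b} = {a..<p} \<union> {p..b}" using assms by auto
  then show "(\<Sum>j=a..b. x j) = (\<Sum>j\<in>{a..<p}. x j) + (\<Sum>j=p..b. x j)"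
    by (auto intro: sum.union_disjoint)
  have "{a..b} = {a..p} \<union> {p + 1..b}" using assms by auto
  then show "(\<Sum>j=a..b. x j) = (\<Sum>j=a..p. x j) + (\<Sum>j=p + 1..b. x j)"
    by (auto intro: sum.union_disjoint)
qed

text \<open>
  For a maximizer \<open>c\<close> of \<open>F\<^sub>l\<close> the numbers \<open>\<phi>\<^sub>l\<close> and \<open>\<epsilon>\<^sub>l\<close> are
  \<open>F\<^sub>l(c)\<close> minus the total of row \<open>l\<close>, respectively of row \<open>l - 1\<close>, and likewise
  for \<open>G\<^sub>l\<close> and the columns \<open>l\<close> and \<open>l + 1\<close>. In this form the vanishing
  of \<open>\<phi>\<^sub>l\<close> and \<open>\<epsilon>\<^sub>l\<close> depends only on the maximum and not on where it is attained.
\<close>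

lemma f_op_row:
  assumes "i < l" "first_max (F i l A) {1..i} c"
  shows "f_op n i m l A = (if F i l A c = (\<Sum>j=1..i. A j l) then None
           else Some (add_entry c (l - 1) (- 1) (add_entry c l 1 A)))"
proof -
  have c: "p_plus i l A = c" using assms by (simp add: p_plus_def Min_maximizers_eq)
  have "1 \<le> c" "c \<le> i" using assms(2) by (auto simp: first_max_def)
  then show ?thesis
    using assms(1) sum_split_at(1)[of 1 c i "\<lambda>j. A j l"]
    by (simp add: f_op_def phi_def c F_def)
qed

lemma e_op_row:
  assumes "i < l" "last_max (F i l A) {1..i} c"
  shows "e_op n i l A = (if F i l A c = (\<Sum>j=1..i. A j (l - 1)) then None
           else Some (add_entry c (l - 1) 1 (add_entry c l (- 1) A)))"
proof -
  have c: "q_plus i l A = c" using assms by (simp add: q_plus_def Max_maximizers_eq)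
  have "1 \<le> c" "c \<le> i" using assms(2) by (auto simp: last_max_def)
  then show ?thesis
    using assms(1) sum_split_at(2)[of 1 c i "\<lambda>j. A j (l - 1)"]
    by (auto simp: e_op_def eps_def c F_def)
qed

lemma f_op_column:
  assumes "l < i" "last_max (G n i l A) {i..n} c"
  shows "f_op n i m l A = (if G n i l A c = (\<Sum>j=i..n. A l j) then None
           else Some (add_entry l c 1 (add_entry (l + 1) c (- 1) A)))"
proof -
  have c: "p_minus n i l A = c" using assms by (simp add: p_minus_def Max_maximizers_eq)
  have "i \<le> c" "c \<le> n" using assms(2) by (auto simp: last_max_def)
  then show ?thesis
    using assms(1) sum_split_at(2)[of i c n "\<lambda>j. A l j"]
    by (auto simp: f_op_def phi_def c G_def)
qed

lemma e_op_column:
  assumes "l < i" "first_max (G n i l A) {i..n} c"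
  shows "e_op n i l A = (if G n i l A c = (\<Sum>j=i..n. A (l + 1) j) then None
           else Some (add_entry l c (- 1) (add_entry (l + 1) c 1 A)))"
proof -
  have c: "q_minus n i l A = c" using assms by (simp add: q_minus_def Min_maximizers_eq)
  have "i \<le> c" "c \<le> n" using assms(2) by (auto simp: first_max_def)
  then show ?thesis
    using assms(1) sum_split_at(1)[of i c n "\<lambda>j. A (l + 1) j"]
    by (auto simp: e_op_def eps_def c G_def)
qed

lemma f_op_node:
  "f_op n i m i A = (if int m = (\<Sum>j\<in>{1..<i}. A j i) + (\<Sum>j=i..n. A i j) then None
     else Some (add_entry i i 1 A))"
  by (auto simp: f_op_def phi_def)

lemma e_op_node: "e_op n i i A = (if A i i = 0 then None else Some (add_entry i i (- 1) A))"
  by (simp add: e_op_def eps_def)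

section \<open>Lattice paths and the polytope\<close>

definition path_sum :: "nat \<Rightarrow> (nat \<Rightarrow> nat \<times> nat) \<Rightarrow> array \<Rightarrow> int" where
  "path_sum n \<beta> A = (\<Sum>s=1..n. case \<beta> s of (p, q) \<Rightarrow> A p q)"

lemma path_step:
  assumes "lattice_path n i \<beta>" "1 \<le> s" "s < n" "\<beta> s = (p, q)"
  shows "\<beta> (Suc s) = (p, q + 1) \<or> \<beta> (Suc s) = (p + 1, q)"
  using assms unfolding lattice_path_def by fastforce

lemma path_cell_antidiagonal:
  assumes "lattice_path n i \<beta>" "1 \<le> s" "s \<le> n"
  shows "fst (\<beta> s) + snd (\<beta> s) = s + i"
  using assms(2,3)
proof (induction s rule: dec_induct)
  case base
  then show ?case using assms(1) by (simp add: lattice_path_def)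
next
  case (step s)
  then show ?case
    using path_step[OF assms(1), of s "fst (\<beta> s)" "snd (\<beta> s)"] assms(2) by auto
qed

lemma path_mono:
  assumes "lattice_path n i \<beta>" "1 \<le> s" "s \<le> t" "t \<le> n"
  shows "fst (\<beta> s) \<le> fst (\<beta> t) \<and> snd (\<beta> s) \<le> snd (\<beta> t)"
  using assms(3,4)
proof (induction t rule: dec_induct)
  case (step t)
  then show ?case
    using path_step[OF assms(1), of t "fst (\<beta> t)" "snd (\<beta> t)"] assms(2) by auto
qed simp

text \<open>
  A path meets a cell at most once, since the antidiagonal of a cell determines the time.
\<close>

lemma path_sum_add_entry:
  assumes "lattice_path n i \<beta>"
  shows "path_sum n \<beta> (add_entry p q d A)
    = path_sum n \<beta> A + (if (p, q) \<in> \<beta> ` {1..n} then d else 0)"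
proof -
  have inj: "inj_on \<beta> {1..n}"
    by (rule inj_onI) (metis assms path_cell_antidiagonal atLeastAtMost_iff add_right_cancel)
  have "path_sum n \<beta> (add_entry p q d A)
      = path_sum n \<beta> A + (\<Sum>s=1..n. (\<lambda>x. if x = (p, q) then d else 0) (\<beta> s))"
    by (auto simp: path_sum_def sum.distrib[symmetric] add_entry_apply split: prod.split
        intro!: sum.cong)
  also have "(\<Sum>s=1..n. (\<lambda>x. if x = (p, q) then d else 0) (\<beta> s))
      = (\<Sum>x\<in>\<beta> ` {1..n}. if x = (p, q) then d else 0)"
    using sum.reindex[OF inj, of "\<lambda>x. if x = (p, q) then d else 0"] by (simp only: o_def)
  also have "\<dots> = (if (p, q) \<in> \<beta> ` {1..n} then d else 0)"
    by (rule sum.delta) simp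
  finally show ?thesis .
qed

lemma polytope_path_sum:
  "A \<in> polytope n i m \<Longrightarrow> lattice_path n i \<beta> \<Longrightarrow> path_sum n \<beta> A \<le> int m"
  by (auto simp: polytope_def path_sum_def)

lemma polytope_nonneg: "A \<in> polytope n i m \<Longrightarrow> 0 \<le> A p q"
  by (auto simp: polytope_def)

lemma polytope_outside:
  "A \<in> polytope n i m \<Longrightarrow> \<not> (1 \<le> p \<and> p \<le> i \<and> i \<le> q \<and> q \<le> n) \<Longrightarrow> A p q = 0"
  by (auto simp: polytope_def)

lemma flip_corner:
  assumes path: "lattice_path n i \<beta>" and s: "1 \<le> s" "s + 2 \<le> n"
    and cells: "\<beta> s = (p, q)" "\<beta> (s + 1) = (p + 1, q)" "\<beta> (s + 2) = (p + 1, q + 1)"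
  defines "\<beta>' \<equiv> \<beta>(s + 1 := (p, q + 1))"
  shows "lattice_path n i \<beta>'"
    and "path_sum n \<beta>' A = path_sum n \<beta> A - A (p + 1) q + A p (q + 1)"
proof -
  show "lattice_path n i \<beta>'"
    using path s cells by (auto simp: lattice_path_def \<beta>'_def)
  have mem: "s + 1 \<in> {1..n}" using s by simp
  have split: "path_sum n \<gamma> A = (case \<gamma> (s + 1) of (p, q) \<Rightarrow> A p q)
      + (\<Sum>t\<in>{1..n} - {s + 1}. case \<gamma> t of (p, q) \<Rightarrow> A p q)" for \<gamma>
    unfolding path_sum_def by (rule sum.remove[OF _ mem]) simp
  have "(\<Sum>t\<in>{1..n} - {s + 1}. case \<beta>' t of (p, q) \<Rightarrow> A p q)
      = (\<Sum>t\<in>{1..n} - {s + 1}. case \<beta> t of (p, q) \<Rightarrow> A p q)"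
    by (rule sum.cong) (auto simp: \<beta>'_def)
  then show "path_sum n \<beta>' A = path_sum n \<beta> A - A (p + 1) q + A p (q + 1)"
    unfolding split using cells(2) by (simp add: \<beta>'_def)
qed

text \<open>
  Suppose the path runs along row \<open>r\<close> from column \<open>q\<close> to column \<open>q + d\<close> and then moves on
  to row \<open>r + 1\<close>. Flipping the corner at the end of this run moves the place of descent one
  column back and changes the weight by the corresponding difference of \<open>F\<^bsub>r+1\<^esub>\<close>. After
  \<open>d\<close> flips the descent happens at \<open>q\<close>, and the bound \<open>m\<close> for that path is the claim.
\<close>

lemma path_sum_bound_row:
  assumes A: "A \<in> polytope n i m"
    and "lattice_path n i \<beta>" "1 \<le> s" "s + d + 1 \<le> n" "q + d \<le> i"
    and "\<forall>j\<le>d. \<beta> (s + j) = (q + j, r)" "\<beta> (s + d + 1) = (q + d, r + 1)"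
  shows "path_sum n \<beta> A + F i (r + 1) A q - F i (r + 1) A (q + d) \<le> int m"
  using assms(2-)
proof (induction d arbitrary: \<beta>)
  case 0
  then show ?case using polytope_path_sum[OF A] by simp
next
  case (Suc d)
  let ?\<beta> = "\<beta>(s + d + 1 := (q + d, r + 1))"
  have *: "\<beta> (s + d) = (q + d, r)" "\<beta> (s + d + 1) = (q + d + 1, r)"
    "\<beta> (s + d + 2) = (q + d + 1, r + 1)"
    using Suc.prems(5,6) by (auto dest: spec[of _ d] spec[of _ "Suc d"])
  have "1 \<le> s + d" "s + d + 2 \<le> n" using Suc.prems by auto
  note flip = flip_corner[OF Suc.prems(1) this *]
  have "path_sum n ?\<beta> A + F i (r + 1) A q - F i (r + 1) A (q + d) \<le> int m"
  proof (rule Suc.IH)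
    show "lattice_path n i ?\<beta>" by (rule flip(1))
  qed (use Suc.prems in auto)
  moreover have "F i (r + 1) A (q + Suc d)
      = F i (r + 1) A (q + d) + A (q + d + 1) r - A (q + d) (r + 1)"
    using F_Suc[of "q + d" i "r + 1" A] Suc.prems(4) by simp
  ultimately show ?case using flip(2)[of A] by simp
qed

text \<open>
  The transposed argument: the path passes from column \<open>l\<close> to column \<open>l + 1\<close> in row \<open>c\<close>
  and flips postpone this passage to row \<open>c + d\<close>.
\<close>

lemma path_sum_bound_column:
  assumes A: "A \<in> polytope n i m"
    and "lattice_path n i \<beta>" "1 \<le> s" "s + d + 1 \<le> n" "i \<le> c" "c + d \<le> n"
    and "\<beta> s = (l, c)" "\<forall>j\<le>d. \<beta> (s + 1 + j) = (l + 1, c + j)"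
  shows "path_sum n \<beta> A + G n i l A (c + d) - G n i l A c \<le> int m"
  using assms(2-)
proof (induction d arbitrary: \<beta> s c)
  case 0
  then show ?case using polytope_path_sum[OF A] by simp
next
  case (Suc d)
  let ?\<beta> = "\<beta>(s + 1 := (l, c + 1))"
  have *: "\<beta> s = (l, c)" "\<beta> (s + 1) = (l + 1, c)" "\<beta> (s + 2) = (l + 1, c + 1)"
    using Suc.prems(6,7) by (auto dest: spec[of _ 0] spec[of _ "Suc 0"])
  have "s + 2 \<le> n" using Suc.prems by auto
  note flip = flip_corner[OF Suc.prems(1,2) this *]
  have shifted: "\<forall>j\<le>d. \<beta> (s + 1 + 1 + j) = (l + 1, c + 1 + j)"
    using Suc.prems(7) by (auto dest: spec[of _ "Suc _"])
  have "path_sum n ?\<beta> A + G n i l A (c + 1 + d) - G n i l A (c + 1) \<le> int m"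
  proof (rule Suc.IH[where s = "s + 1"])
    show "lattice_path n i ?\<beta>" by (rule flip(1))
  qed (use Suc.prems shifted in auto)
  moreover have "G n i l A (c + 1) = G n i l A c + A l (c + 1) - A (l + 1) c"
    using G_Suc[of i c n l A] Suc.prems by simp
  ultimately show ?case using flip(2)[of A] by simp
qed

lemma path_leaves_row:
  assumes path: "lattice_path n i \<beta>" and "1 \<le> s" "s \<le> n" "\<beta> s = (q, r)" "r < n"
  obtains d where "s + d + 1 \<le> n" "\<forall>j\<le>d. \<beta> (s + j) = (q + j, r)"
    "\<beta> (s + d + 1) = (q + d, r + 1)"
proof -
  have "\<exists>d. s + d + 1 \<le> n \<and> (\<forall>j\<le>d. \<beta> (s + j) = (q + j, r)) \<and> \<beta> (s + d + 1) = (q + d, r + 1)"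
    using assms(3,2,4)
  proof (induction s arbitrary: q rule: inc_induct)
    case base
    then show ?case using path \<open>r < n\<close> by (simp add: lattice_path_def)
  next
    case (step s)
    then consider "\<beta> (Suc s) = (q, r + 1)" | "\<beta> (Suc s) = (q + 1, r)"
      using path_step[OF path, of s q r] by auto
    then show ?case
    proof cases
      case 1
      then show ?thesis using step by (intro exI[of _ 0]) auto
    next
      case 2
      with step.IH[of "q + 1"] obtain d where d: "Suc s + d + 1 \<le> n"
        "\<forall>j\<le>d. \<beta> (Suc s + j) = (q + 1 + j, r)" "\<beta> (Suc s + d + 1) = (q + 1 + d, r + 1)"
        by auto
      have "\<beta> (s + j) = (q + j, r)" if "j \<le> Suc d" for j
        using that d(2) step.prems by (cases j) auto
      then show ?thesis using d by (intro exI[of _ "Suc d"]) auto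
    qed
  qed
  then show thesis using that by blast
qed

lemma path_enters_column:
  assumes path: "lattice_path n i \<beta>" and "1 \<le> s" "s \<le> n" "\<beta> s = (l + 1, q)" "1 \<le> l"
  obtains u c d where "1 \<le> u" "u + d + 1 = s" "q = c + d" "\<beta> u = (l, c)"
    "\<forall>j\<le>d. \<beta> (u + 1 + j) = (l + 1, c + j)"
proof -
  have "\<exists>u c d. 1 \<le> u \<and> u + d + 1 = s \<and> q = c + d \<and> \<beta> u = (l, c) \<and>
      (\<forall>j\<le>d. \<beta> (u + 1 + j) = (l + 1, c + j))"
    using assms(2,3,4)
  proof (induction s arbitrary: q rule: dec_induct)
    case base
    then show ?case using path \<open>1 \<le> l\<close> by (simp add: lattice_path_def)
  next
    case (step s)
    obtain p' q' where pq: "\<beta> s = (p', q')" by force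
    have "\<beta> (Suc s) = (p', q' + 1) \<or> \<beta> (Suc s) = (p' + 1, q')"
      using path_step[OF path _ _ pq] step by simp
    then consider "\<beta> s = (l, q)" | "\<beta> s = (l + 1, q')" "q = q' + 1"
      using step.prems pq by auto
    then show ?case
    proof cases
      case 1
      then show ?thesis using step by (intro exI[of _ s] exI[of _ q] exI[of _ 0]) auto
    next
      case 2
      with step.IH[of q'] step.prems obtain u c d where d: "1 \<le> u" "u + d + 1 = s" "q' = c + d"
        "\<beta> u = (l, c)" "\<forall>j\<le>d. \<beta> (u + 1 + j) = (l + 1, c + j)"
        by auto
      have "\<beta> (u + 1 + j) = (l + 1, c + j)" if "j \<le> Suc d" for j
        using that d 2 step.prems by (cases "j = Suc d") auto
      then show ?thesis using d 2
        by (intro exI[of _ u] exI[of _ c] exI[of _ "Suc d"]) auto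
    qed
  qed
  then show thesis using that by blast
qed

lemma polytopeI:
  assumes "\<And>p q. 0 \<le> A p q"
    and "\<And>p q. \<not> (1 \<le> p \<and> p \<le> i \<and> i \<le> q \<and> q \<le> n) \<Longrightarrow> A p q = 0"
    and "\<And>\<beta>. lattice_path n i \<beta> \<Longrightarrow> path_sum n \<beta> A \<le> int m"
  shows "A \<in> polytope n i m"
  using assms(1,2) assms(3)[unfolded path_sum_def] by (simp add: polytope_def)

text \<open>
  A unit moved from \<open>(p,q)\<close> to \<open>(p',q')\<close> makes only those paths heavier that visit the new
  cell and avoid the old one.
\<close>

lemma polytope_move:
  assumes A: "A \<in> polytope n i m" and pos: "1 \<le> A p q"
    and range: "1 \<le> p'" "p' \<le> i" "i \<le> q'" "q' \<le> n"
    and slack: "\<And>\<beta>. lattice_path n i \<beta> \<Longrightarrow> (p', q') \<in> \<beta> ` {1..n} \<Longrightarrow> (p, q) \<notin> \<beta> ` {1..n}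
      \<Longrightarrow> path_sum n \<beta> A < int m"
  shows "add_entry p' q' 1 (add_entry p q (- 1) A) \<in> polytope n i m"
proof (rule polytopeI)
  show "path_sum n \<beta> (add_entry p' q' 1 (add_entry p q (- 1) A)) \<le> int m"
    if "lattice_path n i \<beta>" for \<beta>
    using slack[OF that] polytope_path_sum[OF A that]
    by (auto simp: path_sum_add_entry[OF that])
  show "0 \<le> add_entry p' q' 1 (add_entry p q (- 1) A) u v" for u v
    using pos polytope_nonneg[OF A, of u v] by (auto simp: add_entry_apply)
  show "add_entry p' q' 1 (add_entry p q (- 1) A) u v = 0"
    if "\<not> (1 \<le> u \<and> u \<le> i \<and> i \<le> v \<and> v \<le> n)" for u v
    using that pos range polytope_outside[OF A that] by (auto simp: add_entry_apply)
qed

lemma polytope_decrease: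
  assumes A: "A \<in> polytope n i m" and pos: "1 \<le> A p q"
  shows "add_entry p q (- 1) A \<in> polytope n i m"
proof (rule polytopeI)
  show "path_sum n \<beta> (add_entry p q (- 1) A) \<le> int m" if "lattice_path n i \<beta>" for \<beta>
    using polytope_path_sum[OF A that] by (auto simp: path_sum_add_entry[OF that])
  show "0 \<le> add_entry p q (- 1) A u v" for u v
    using pos polytope_nonneg[OF A, of u v] by (auto simp: add_entry_apply)
  show "add_entry p q (- 1) A u v = 0"
    if "\<not> (1 \<le> u \<and> u \<le> i \<and> i \<le> v \<and> v \<le> n)" for u v
    using pos polytope_outside[OF A that] by (auto simp: add_entry_apply)
qed



section \<open>Raising operators preserve the polytope\<close>

text \<open>
  For \<open>l > i\<close> a unit moves from row \<open>l\<close> to row \<open>l - 1\<close> in the column \<open>q\<close> of the last maximum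
  of \<open>F\<^sub>l\<close>. A path that gains weight visits \<open>(q,l-1)\<close> and descends at some column
  \<open>q + d\<close> with \<open>d > 0\<close>; there \<open>F\<^sub>l\<close> is strictly smaller than at \<open>q\<close>, so
  \<open>path_sum_bound_row\<close> leaves room for one more unit. For \<open>l < i\<close> the same happens with
  rows and columns exchanged.
\<close>

lemma e_op_polytope:
  assumes A: "A \<in> polytope n i m" and i: "1 \<le> i" "i \<le> n" and l: "1 \<le> l" "l \<le> n"
    and e: "e_op n i l A = Some A'"
  shows "A' \<in> polytope n i m"
proof -
  consider "l = i" | "i < l" | "l < i" by linarith
  then show ?thesis
  proof cases
    case 1
    then have "A i i \<noteq> 0" "A' = add_entry i i (- 1) A"
      using e by (auto simp: e_op_node split: if_splits)
    then show ?thesis using polytope_decrease[OF A, of i i] polytope_nonneg[OF A, of i i] by simp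
  next
    case 2
    obtain q where q: "last_max (F i l A) {1..i} q"
      using last_max_exists[of "{1..i}" "F i l A"] i by auto
    then have q': "1 \<le> q" "q \<le> i" and less: "\<And>t. q < t \<Longrightarrow> t \<le> i \<Longrightarrow> F i l A t < F i l A q"
      by (auto simp: last_max_def)
    have ne: "F i l A q \<noteq> (\<Sum>j=1..i. A j (l - 1))"
      and A': "A' = add_entry q (l - 1) 1 (add_entry q l (- 1) A)"
      using e e_op_row[OF 2 q, of n] by (auto split: if_splits)
    \<comment> \<open>The entry to be lowered is positive because \<open>F\<^sub>l\<close> drops strictly after
      its last maximum; at \<open>q = i\<close> the nonvanishing of \<open>\<epsilon>\<^sub>l\<close> takes over.\<close>
    have "A q l > 0"
    proof (cases "q = i")
      case True
      then show ?thesis using ne polytope_nonneg[OF A, of i l] by (simp add: F_def)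
    next
      case False
      then show ?thesis
        using less[of "Suc q"] F_Suc[of q i l A] q' polytope_nonneg[OF A, of "Suc q" "l - 1"] by simp
    qed
    moreover have "path_sum n \<beta> A < int m"
      if \<beta>: "lattice_path n i \<beta>" "(q, l - 1) \<in> \<beta> ` {1..n}" "(q, l) \<notin> \<beta> ` {1..n}" for \<beta>
    proof -
      obtain s where s: "1 \<le> s" "s \<le> n" "\<beta> s = (q, l - 1)" using \<beta>(2) by force
      obtain d where d: "s + d + 1 \<le> n" "\<forall>j\<le>d. \<beta> (s + j) = (q + j, l - 1)"
        "\<beta> (s + d + 1) = (q + d, l - 1 + 1)"
      proof (rule path_leaves_row[OF \<beta>(1) s])
        show "l - 1 < n" using l by simp
      qed
      have "d \<noteq> 0"
      proof
        assume "d = 0"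
        then have "(q, l) = \<beta> (s + 1)" "s + 1 \<in> {1..n}" using d 2 by auto
        then show False using \<beta>(3) by blast
      qed
      have "\<beta> n = (i, n)" using \<beta>(1) by (simp add: lattice_path_def)
      then have qd: "q + d \<le> i"
        using path_mono[OF \<beta>(1), of "s + d" n] d s(1) by simp
      have "path_sum n \<beta> A + F i l A q - F i l A (q + d) \<le> int m"
        using path_sum_bound_row[OF A \<beta>(1) s(1) d(1) qd d(2,3)] 2 by simp
      then show ?thesis using less[of "q + d"] \<open>d \<noteq> 0\<close> qd by simp
    qed
    ultimately show ?thesis
      unfolding A' using q' l 2 by (intro polytope_move[OF A]) auto
  next
    case 3
    obtain q where q: "first_max (G n i l A) {i..n} q"
      using first_max_exists[of "{i..n}" "G n i l A"] i by auto
    then have q': "i \<le> q" "q \<le> n" and less: "\<And>t. t < q \<Longrightarrow> i \<le> t \<Longrightarrow> G n i l A t < G n i l A q"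
      by (auto simp: first_max_def)
    have ne: "G n i l A q \<noteq> (\<Sum>j=i..n. A (l + 1) j)"
      and A': "A' = add_entry (l + 1) q 1 (add_entry l q (- 1) A)"
      using e e_op_column[OF 3 q] by (auto simp: add_entry_commute split: if_splits)
    have "A l q > 0"
    proof (cases "q = i")
      case True
      then show ?thesis using ne polytope_nonneg[OF A, of l i] by (simp add: G_def)
    next
      case False
      then obtain t where t: "q = Suc t" "i \<le> t" using q' by (cases q) auto
      then show ?thesis
        using less[of t] G_Suc[of i t n l A] q' polytope_nonneg[OF A, of "l + 1" t] by simp
    qed
    moreover have "path_sum n \<beta> A < int m"
      if \<beta>: "lattice_path n i \<beta>" "(l + 1, q) \<in> \<beta> ` {1..n}" "(l, q) \<notin> \<beta> ` {1..n}" for \<beta>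
    proof -
      obtain s where s: "1 \<le> s" "s \<le> n" "\<beta> s = (l + 1, q)" using \<beta>(2) by force
      obtain u c d where u: "1 \<le> u" "u + d + 1 = s" "q = c + d" "\<beta> u = (l, c)"
        "\<forall>j\<le>d. \<beta> (u + 1 + j) = (l + 1, c + j)"
        using path_enters_column[OF \<beta>(1) s l(1)] by blast
      have "d \<noteq> 0"
      proof
        assume "d = 0"
        then have "(l, q) = \<beta> u" "u \<in> {1..n}" using u s by auto
        then show False using \<beta>(3) by blast
      qed
      have "\<beta> 1 = (1, i)" using \<beta>(1) by (simp add: lattice_path_def)
      then have c: "i \<le> c"
        using path_mono[OF \<beta>(1), of 1 u] u s by simp
      have "path_sum n \<beta> A + G n i l A q - G n i l A c \<le> int m"
        using path_sum_bound_column[OF A \<beta>(1) u(1) _ c _ u(4,5)] u(2,3) s q' by simp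
      then show ?thesis using less[of c] \<open>d \<noteq> 0\<close> c u(3) by simp
    qed
    ultimately show ?thesis
      unfolding A' using q' l 3 by (intro polytope_move[OF A]) auto
  qed
qed

section \<open>Two distinguished paths\<close>

text \<open>
  The path that turns at \<open>(i,i)\<close>, along row \<open>i\<close> and then along column \<open>i\<close>, shows
  \<open>\<phi>\<^sub>i \<ge> 0\<close>.
\<close>

lemma node_path_bound:
  assumes A: "A \<in> polytope n i m" and i: "1 \<le> i" "i \<le> n"
  shows "(\<Sum>j\<in>{1..<i}. A j i) + (\<Sum>j=i..n. A i j) \<le> int m"
proof -
  define \<beta> where "\<beta> = (\<lambda>s. if s \<le> i then (s, i) else (i, s))"
  have "lattice_path n i \<beta>" using i by (auto simp: lattice_path_def \<beta>_def)
  moreover have "path_sum n \<beta> A = (\<Sum>j\<in>{1..<i}. A j i) + (\<Sum>j=i..n. A i j)"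
    unfolding path_sum_def sum_split_at(1)[OF i]
    by (intro arg_cong2[where f = "(+)"] sum.cong) (auto simp: \<beta>_def)
  ultimately show ?thesis using polytope_path_sum[OF A] by metis
qed

text \<open>
  The path through \<open>(1,n)\<close>: down column 1 and then along row \<open>n\<close>. The turn happens at the
  time \<open>n + 1 - i\<close>.
\<close>

definition corner_path :: "nat \<Rightarrow> nat \<Rightarrow> nat \<Rightarrow> nat \<times> nat" where
  "corner_path n i s = (if s \<le> n + 1 - i then (1, s + i - 1) else (s + i - n, n))"

lemma corner_path:
  assumes "1 \<le> i" "i \<le> n"
  shows "lattice_path n i (corner_path n i)"
    and "path_sum n (corner_path n i) A = (\<Sum>j=i..n. A 1 j) + (\<Sum>j=2..i. A j n)"
proof -
  show "lattice_path n i (corner_path n i)"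
    using assms by (auto simp: lattice_path_def corner_path_def)
  have "(\<Sum>s=1..n + 1 - i. case corner_path n i s of (p, q) \<Rightarrow> A p q) = (\<Sum>j=i..n. A 1 j)"
    using assms
    by (intro sum.reindex_bij_witness[of _ "\<lambda>j. j + 1 - i" "\<lambda>s. s + i - 1"])
      (auto simp: corner_path_def)
  moreover have "(\<Sum>s=n + 1 - i + 1..n. case corner_path n i s of (p, q) \<Rightarrow> A p q)
      = (\<Sum>j=2..i. A j n)"
    using assms
    by (intro sum.reindex_bij_witness[of _ "\<lambda>j. j + n - i" "\<lambda>s. s + i - n"])
      (auto simp: corner_path_def)
  ultimately show "path_sum n (corner_path n i) A = (\<Sum>j=i..n. A 1 j) + (\<Sum>j=2..i. A j n)"
    using sum_split_at(2)[of 1 "n + 1 - i" n] assms by (simp add: path_sum_def)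
qed

lemma path_through_corner:
  assumes \<beta>: "lattice_path n i \<beta>" "(1, n) \<in> \<beta> ` {1..n}" and s: "s \<in> {1..n}"
  shows "\<beta> s = corner_path n i s"
proof -
  obtain u where u: "1 \<le> u" "u \<le> n" "\<beta> u = (1, n)" using \<beta>(2) by force
  have ends: "\<beta> 1 = (1, i)" "\<beta> n = (i, n)" using \<beta>(1) by (auto simp: lattice_path_def)
  have diag: "fst (\<beta> s) + snd (\<beta> s) = s + i" "1 + n = u + i"
    using path_cell_antidiagonal[OF \<beta>(1), of s] path_cell_antidiagonal[OF \<beta>(1), of u] s u by auto
  show ?thesis
  proof (cases "s \<le> u")
    case True
    then have "fst (\<beta> s) = 1"
      using path_mono[OF \<beta>(1), of s u] path_mono[OF \<beta>(1), of 1 s] s u ends by simp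
    then show ?thesis using diag True by (auto simp: corner_path_def prod_eq_iff)
  next
    case False
    then have "snd (\<beta> s) = n"
      using path_mono[OF \<beta>(1), of u s] path_mono[OF \<beta>(1), of s n] s u ends by simp
    then show ?thesis using diag False by (auto simp: corner_path_def prod_eq_iff)
  qed
qed

lemma eps0_nonneg:
  assumes "A \<in> polytope n i m" "1 \<le> i" "i \<le> n"
  shows "0 \<le> eps0 n i m A"
  using polytope_path_sum[OF assms(1) corner_path(1)[OF assms(2,3)]]
    corner_path(2)[OF assms(2,3), of A] by (simp add: eps0_def)

lemma polytope_increase_corner:
  assumes A: "A \<in> polytope n i m" and i: "1 \<le> i" "i \<le> n" and pos: "eps0 n i m A > 0"
  shows "add_entry 1 n 1 A \<in> polytope n i m"
proof (rule polytopeI)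
  fix \<beta> assume \<beta>: "lattice_path n i \<beta>"
  have "path_sum n \<beta> A < int m" if "(1, n) \<in> \<beta> ` {1..n}"
  proof -
    have "path_sum n \<beta> A = path_sum n (corner_path n i) A"
      unfolding path_sum_def using path_through_corner[OF \<beta> that] by (intro sum.cong) auto
    then show ?thesis using pos corner_path(2)[OF i, of A] by (simp add: eps0_def)
  qed
  then show "path_sum n \<beta> (add_entry 1 n 1 A) \<le> int m"
    using polytope_path_sum[OF A \<beta>] by (auto simp: path_sum_add_entry[OF \<beta>])
next
  show "0 \<le> add_entry 1 n 1 A p q" for p q
    using polytope_nonneg[OF A, of p q] by (auto simp: add_entry_apply)
  show "add_entry 1 n 1 A p q = 0" if "\<not> (1 \<le> p \<and> p \<le> i \<and> i \<le> q \<and> q \<le> n)" for p q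
    using i that polytope_outside[OF A that] by (auto simp: add_entry_apply)
qed

section \<open>Raising and lowering operators are mutually inverse\<close>

text \<open>
  Moving a unit at the last maximum \<open>q\<close> of \<open>F\<^sub>l\<close> lowers \<open>F\<^sub>l\<close> by one before \<open>q\<close>,
  raises it by one after \<open>q\<close> and keeps the value at \<open>q\<close>. The values after \<open>q\<close> were
  strictly smaller, so \<open>q\<close> becomes the first maximum, which is where the lowering operator
  acts. The same comparison, with the directions adapted, serves \<open>G\<^sub>l\<close> and the converse
  \<open>e_op_f_op\<close>.
\<close>

lemma f_op_e_op:
  assumes A: "A \<in> polytope n i m" and i: "1 \<le> i" "i \<le> n"
    and e: "e_op n i l A = Some A'"
  shows "f_op n i m l A' = Some A"
proof -
  consider "l = i" | "i < l" | "l < i" by linarith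
  then show ?thesis
  proof cases
    case 1
    then have "A' = add_entry i i (- 1) A" using e by (auto simp: e_op_node split: if_splits)
    then show ?thesis
      using node_path_bound[OF A i] 1 i
      by (simp add: f_op_node row_sum_add_entry column_sum_add_entry add_entry_cancel)
  next
    case 2
    obtain q where q: "last_max (F i l A) {1..i} q"
      using last_max_exists[of "{1..i}" "F i l A"] i by auto
    have A': "A' = add_entry q (l - 1) 1 (add_entry q l (- 1) A)"
      using e e_op_row[OF 2 q, of n] by (auto split: if_splits)
    have F': "F i l A' t = F i l A t + (if t < q then - 1 else if t = q then 0 else 1)"
      if "t \<in> {1..i}" for t
      using that q 2 by (auto simp: A' F_add_entry last_max_def)
    have q': "first_max (F i l A') {1..i} q"
      using q F' by (fastforce simp: first_max_def last_max_def)
    have "F i l A 1 \<le> F i l A q" using q i by (auto simp: last_max_def)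
    then have "(\<Sum>j=1..i. A j l) \<le> F i l A q"
      using polytope_nonneg[OF A, of 1 "l - 1"] by (simp add: F_def)
    moreover have restore: "add_entry q (l - 1) (- 1) (add_entry q l 1 A') = A"
      by (intro ext) (auto simp: A' add_entry_apply)
    moreover have "F i l A' q = F i l A q" "(\<Sum>j=1..i. A' j l) = (\<Sum>j=1..i. A j l) - 1"
      using F' q 2 by (auto simp: A' row_sum_add_entry last_max_def)
    ultimately show ?thesis
      using f_op_row[OF 2 q', of n m] restore by simp
  next
    case 3
    obtain q where q: "first_max (G n i l A) {i..n} q"
      using first_max_exists[of "{i..n}" "G n i l A"] i by auto
    have A': "A' = add_entry l q (- 1) (add_entry (l + 1) q 1 A)"
      using e e_op_column[OF 3 q] by (auto split: if_splits)
    have G': "G n i l A' t = G n i l A t + (if t < q then 1 else if t = q then 0 else - 1)"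
      if "t \<in> {i..n}" for t
      using that q by (auto simp: A' G_add_entry first_max_def)
    have q': "last_max (G n i l A') {i..n} q"
      using q G' by (fastforce simp: first_max_def last_max_def)
    have "G n i l A n \<le> G n i l A q" using q i by (auto simp: first_max_def)
    then have "(\<Sum>j=i..n. A l j) \<le> G n i l A q"
      using polytope_nonneg[OF A, of "l + 1" n] by (simp add: G_def)
    moreover have restore: "add_entry l q 1 (add_entry (l + 1) q (- 1) A') = A"
      by (intro ext) (auto simp: A' add_entry_apply)
    moreover have "G n i l A' q = G n i l A q" "(\<Sum>j=i..n. A' l j) = (\<Sum>j=i..n. A l j) - 1"
      using G' q by (auto simp: A' column_sum_add_entry first_max_def)
    ultimately show ?thesis
      using f_op_column[OF 3 q', of m] restore by simp
  qed
qed

lemma e_op_f_op: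
  assumes A: "A \<in> polytope n i m" and i: "1 \<le> i" "i \<le> n"
    and f: "f_op n i m l A = Some A'"
  shows "e_op n i l A' = Some A"
proof -
  consider "l = i" | "i < l" | "l < i" by linarith
  then show ?thesis
  proof cases
    case 1
    then have "A' = add_entry i i 1 A" using f by (auto simp: f_op_node split: if_splits)
    then show ?thesis
      using polytope_nonneg[OF A, of i i] 1 add_entry_cancel[of "- 1" 1 i i A]
      by (simp add: e_op_node add_entry_apply)
  next
    case 2
    obtain p where p: "first_max (F i l A) {1..i} p"
      using first_max_exists[of "{1..i}" "F i l A"] i by auto
    have A': "A' = add_entry p (l - 1) (- 1) (add_entry p l 1 A)"
      using f f_op_row[OF 2 p, of n] by (auto split: if_splits)
    have F': "F i l A' t = F i l A t + (if t < p then 1 else if t = p then 0 else - 1)"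
      if "t \<in> {1..i}" for t
      using that p 2 by (auto simp: A' F_add_entry first_max_def)
    have p': "last_max (F i l A') {1..i} p"
      using p F' by (fastforce simp: first_max_def last_max_def)
    have "F i l A i \<le> F i l A p" using p i by (auto simp: first_max_def)
    then have "(\<Sum>j=1..i. A j (l - 1)) \<le> F i l A p"
      using polytope_nonneg[OF A, of i l] by (simp add: F_def)
    moreover have restore: "add_entry p (l - 1) 1 (add_entry p l (- 1) A') = A"
      by (intro ext) (auto simp: A' add_entry_apply)
    moreover have "F i l A' p = F i l A p"
      "(\<Sum>j=1..i. A' j (l - 1)) = (\<Sum>j=1..i. A j (l - 1)) - 1"
      using F' p 2 by (auto simp: A' row_sum_add_entry first_max_def)
    ultimately show ?thesis
      using e_op_row[OF 2 p', of n] restore by simp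
  next
    case 3
    obtain p where p: "last_max (G n i l A) {i..n} p"
      using last_max_exists[of "{i..n}" "G n i l A"] i by auto
    have A': "A' = add_entry l p 1 (add_entry (l + 1) p (- 1) A)"
      using f f_op_column[OF 3 p] by (auto split: if_splits)
    have G': "G n i l A' t = G n i l A t + (if t < p then - 1 else if t = p then 0 else 1)"
      if "t \<in> {i..n}" for t
      using that p by (auto simp: A' G_add_entry last_max_def)
    have p': "first_max (G n i l A') {i..n} p"
      using p G' by (fastforce simp: first_max_def last_max_def)
    have "G n i l A i \<le> G n i l A p" using p i by (auto simp: last_max_def)
    then have "(\<Sum>j=i..n. A (l + 1) j) \<le> G n i l A p"
      using polytope_nonneg[OF A, of l i] by (simp add: G_def)
    moreover have restore: "add_entry l p (- 1) (add_entry (l + 1) p 1 A') = A"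
      by (intro ext) (auto simp: A' add_entry_apply)
    moreover have "G n i l A' p = G n i l A p"
      "(\<Sum>j=i..n. A' (l + 1) j) = (\<Sum>j=i..n. A (l + 1) j) - 1"
      using G' p by (auto simp: A' column_sum_add_entry last_max_def)
    ultimately show ?thesis
      using e_op_column[OF 3 p'] restore by simp
  qed
qed

section \<open>A grading by height\<close>

text \<open>
  The entry \<open>a\<^bsub>p,q\<^esub>\<close> is weighted by the height of the root \<open>\<alpha>\<^bsub>p,q\<^esub>\<close>, so that
  this is the height of \<open>m\<omega>\<^sub>i - wt(A)\<close>. It is the measure for the induction along raising
  operators.
\<close>

definition level :: "nat \<Rightarrow> nat \<Rightarrow> array \<Rightarrow> int" where
  "level n i A = (\<Sum>(p, q)\<in>{1..i} \<times> {i..n}. (int q + 1 - int p) * A p q)"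

lemma level_add_entry:
  assumes "(p, q) \<in> {1..i} \<times> {i..n}"
  shows "level n i (add_entry p q d A) = level n i A + (int q + 1 - int p) * d"
proof -
  have "level n i (add_entry p q d A) = (\<Sum>x\<in>{1..i} \<times> {i..n}.
      (case x of (p, q) \<Rightarrow> (int q + 1 - int p) * A p q)
      + (if x = (p, q) then (int q + 1 - int p) * d else 0))"
    unfolding level_def by (rule sum.cong) (auto simp: add_entry_apply distrib_left split: if_splits)
  also have "\<dots> = level n i A + (int q + 1 - int p) * d"
    using assms by (subst sum.distrib) (simp add: level_def)
  finally show ?thesis .
qed

lemma level_nonneg: "A \<in> polytope n i m \<Longrightarrow> 0 \<le> level n i A"
  unfolding level_def by (rule sum_nonneg) (auto simp: polytope_nonneg)

lemma level_e_op:
  assumes i: "1 \<le> i" "i \<le> n" and l: "1 \<le> l" "l \<le> n" and e: "e_op n i l A = Some A'"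
  shows "level n i A' = level n i A - 1"
proof -
  consider "l = i" | "i < l" | "l < i" by linarith
  then show ?thesis
  proof cases
    case 1
    then show ?thesis using e i by (auto simp: e_op_node level_add_entry split: if_splits)
  next
    case 2
    obtain q where q: "last_max (F i l A) {1..i} q"
      using last_max_exists[of "{1..i}" "F i l A"] i by auto
    then have "1 \<le> q" "q \<le> i" by (auto simp: last_max_def)
    moreover have "A' = add_entry q (l - 1) 1 (add_entry q l (- 1) A)"
      using e e_op_row[OF 2 q, of n] by (auto split: if_splits)
    moreover obtain r where "l = Suc r" "i \<le> r" using 2 by (cases l) auto
    ultimately show ?thesis using l by (simp add: level_add_entry)
  next
    case 3
    obtain q where q: "first_max (G n i l A) {i..n} q"
      using first_max_exists[of "{i..n}" "G n i l A"] i by auto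
    then have "i \<le> q" "q \<le> n" by (auto simp: first_max_def)
    moreover have "A' = add_entry l q (- 1) (add_entry (l + 1) q 1 A)"
      using e e_op_column[OF 3 q] by (auto split: if_splits)
    ultimately show ?thesis using 3 l by (simp add: level_add_entry)
  qed
qed

section \<open>Commutation relations\<close>

text \<open>
  For \<open>2 \<le> l < n\<close> the operators at \<open>l\<close> never meet the cell \<open>(1,n)\<close>: for \<open>l < i\<close> they
  stay in the columns \<open>l\<close> and \<open>l + 1\<close>, for \<open>l > i\<close> in the rows \<open>l - 1\<close> and \<open>l\<close>, and for
  \<open>l = i\<close> in the column \<open>i > 1\<close> and the row \<open>i < n\<close>.
\<close>

lemma f_op_add_corner:
  assumes l: "2 \<le> l" "l < n"
  shows "f_op n i m l (add_entry 1 n d A) = map_option (add_entry 1 n d) (f_op n i m l A)"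
proof -
  have "F i l (add_entry 1 n d A) = F i l A" if "i < l"
    using l by (intro ext) (auto simp: F_add_entry)
  then have "p_plus i l (add_entry 1 n d A) = p_plus i l A" if "i < l"
    using that by (simp add: p_plus_def)
  moreover have "G n i l (add_entry 1 n d A) = G n i l A"
    using l by (intro ext) (auto simp: G_add_entry)
  then have "p_minus n i l (add_entry 1 n d A) = p_minus n i l A"
    by (simp add: p_minus_def)
  moreover have "add_entry p q a (add_entry 1 n d A) = add_entry 1 n d (add_entry p q a A)" for p q a A
    by (rule add_entry_commute)
  moreover have "l - 1 \<noteq> n" using l by simp
  ultimately show ?thesis
    using l by (simp add: f_op_def phi_def row_sum_add_entry column_sum_add_entry Let_def)
qed

lemma f_op_corner_entry:
  assumes "2 \<le> l" "l < n" "f_op n i m l A = Some A'"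
  shows "A' 1 n = A 1 n"
  using assms by (auto simp: f_op_def Let_def add_entry_apply split: if_splits)

lemma e_op_add_corner:
  assumes l: "2 \<le> l" "l < n"
  shows "e_op n i l (add_entry 1 n d A) = map_option (add_entry 1 n d) (e_op n i l A)"
proof -
  have "F i l (add_entry 1 n d A) = F i l A" if "i < l"
    using l by (intro ext) (auto simp: F_add_entry)
  then have "q_plus i l (add_entry 1 n d A) = q_plus i l A" if "i < l"
    using that by (simp add: q_plus_def)
  moreover have "G n i l (add_entry 1 n d A) = G n i l A"
    using l by (intro ext) (auto simp: G_add_entry)
  then have "q_minus n i l (add_entry 1 n d A) = q_minus n i l A"
    by (simp add: q_minus_def)
  moreover have "add_entry p q a (add_entry 1 n d A) = add_entry 1 n d (add_entry p q a A)" for p q a A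
    by (rule add_entry_commute)
  moreover have "l - 1 \<noteq> n" using l by simp
  moreover have "add_entry 1 n d A i i = A i i" if "l = i" using l that by (simp add: add_entry_apply)
  ultimately show ?thesis
    using l by (simp add: e_op_def eps_def row_sum_add_entry column_sum_add_entry Let_def)
qed

text \<open>
  Only the case \<open>1 < i < k\<close> has content: \<open>f\<^sub>1\<close> moves a unit from column 2 to column 1 in
  the row \<open>p\<close> of the last maximum of \<open>G\<^sub>1\<close>, while \<open>f\<^sub>k\<close> moves a unit from row
  \<open>k - 1\<close> to row \<open>k\<close> in the column \<open>c\<close> of the first maximum of \<open>F\<^sub>k\<close>. They can
  interact only in the four cells with columns 1, 2 and rows \<open>k - 1\<close>, \<open>k\<close>. There
  \<open>F\<^sub>k(2) - F\<^sub>k(1) = G\<^sub>1(k-1) - G\<^sub>1(k)\<close>, both sides being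
  \<open>a\<^bsub>2,k-1\<^esub> - a\<^bsub>1,k\<^esub>\<close>. Comparing \<open>F\<^sub>k\<close> and \<open>G\<^sub>1\<close> through this identity
  shows that neither operator changes the maximum seen by the other one. The place of the
  maximum moves only if \<open>p = k - 1\<close>, \<open>c = 2\<close> and the common difference is 1. Then, if
  applied second, \<open>f\<^sub>1\<close> acts at \<open>k\<close> instead of \<open>k - 1\<close>, and \<open>f\<^sub>k\<close> acts at 1
  instead of 2. In either order the net effect is a unit moved from \<open>(2,k-1)\<close> to \<open>(1,k)\<close>.
\<close>

lemma f_op_1_commute:
  assumes i: "1 \<le> i" "i \<le> n" and k: "3 \<le> k" "k \<le> n" and f: "f_op n i m k B = Some B'"
  shows "f_op n i m 1 B' = Option.bind (f_op n i m 1 B) (f_op n i m k)"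
proof (cases "i = 1")
  case True
  have c: "first_max (F i k X) {1..i} 1" for X using True by (simp add: first_max_def)
  have B': "B' = add_entry 1 (k - 1) (- 1) (add_entry 1 k 1 B)"
    and ne: "F i k B 1 \<noteq> (\<Sum>j=1..i. B j k)"
    using f f_op_row[OF _ c[of B], of n m] True k by (auto split: if_splits)
  have "F i k (add_entry 1 1 1 B) 1 = F i k B 1"
    "(\<Sum>j=1..i. add_entry 1 1 1 B j k) = (\<Sum>j=1..i. B j k)"
    using k by (simp_all add: F_add_entry row_sum_add_entry)
  then have "f_op n i m k (add_entry 1 1 1 B)
      = Some (add_entry 1 (k - 1) (- 1) (add_entry 1 k 1 (add_entry 1 1 1 B)))"
    using f_op_row[OF _ c[of "add_entry 1 1 1 B"], of n m] ne True k by simp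
  moreover have "add_entry 1 1 1 B' = add_entry 1 (k - 1) (- 1) (add_entry 1 k 1 (add_entry 1 1 1 B))"
    by (intro ext) (simp add: B' add_entry_apply)
  moreover have "1 \<le> k - 1" "k - 1 \<le> n" using k by auto
  then have "(\<Sum>j=1..n. B' 1 j) = (\<Sum>j=1..n. B 1 j)"
    using k by (simp add: B' column_sum_add_entry)
  ultimately show ?thesis
    using True f_op_node[of n 1 m B] f_op_node[of n 1 m B'] by simp
next
  case False
  then have i1: "1 < i" using i by simp
  obtain p where p: "last_max (G n i 1 B) {i..n} p"
    using last_max_exists[of "{i..n}" "G n i 1 B"] i by auto
  then have p': "i \<le> p" "p \<le> n" by (auto simp: last_max_def)
  define C where "C = add_entry 1 p 1 (add_entry 2 p (- 1) B)"
  have f1: "f_op n i m 1 B = (if G n i 1 B p = (\<Sum>j=i..n. B 1 j) then None else Some C)"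
    using f_op_column[OF i1 p, of m] by (simp add: C_def numeral_2_eq_2)
  consider "k = i" | "k < i" | "i < k" by linarith
  then show ?thesis
  proof cases
    case 1
    have B': "B' = add_entry i i 1 B" and ne: "int m \<noteq> (\<Sum>j\<in>{1..<i}. B j i) + (\<Sum>j=i..n. B i j)"
      using f 1 f_op_node[of n i m B] by (auto split: if_splits)
    have "f_op n i m k C = Some (add_entry i i 1 C)"
      using ne 1 k unfolding C_def
      by (auto simp: f_op_node row_sum_add_entry column_sum_add_entry)
    moreover have "G n i 1 B' = G n i 1 B"
      using 1 k unfolding B' by (intro ext) (simp add: G_add_entry)
    then have "f_op n i m 1 B' = (if G n i 1 B p = (\<Sum>j=i..n. B 1 j) then None
        else Some (add_entry 1 p 1 (add_entry 2 p (- 1) B')))"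
      using f_op_column[OF i1, of n B' p m] p 1 k
      by (simp add: numeral_2_eq_2 B' column_sum_add_entry)
    ultimately show ?thesis
      using f1 B' C_def add_entry_commute by auto
  next
    case 2
    obtain c where c: "last_max (G n i k B) {i..n} c"
      using last_max_exists[of "{i..n}" "G n i k B"] i by auto
    have B': "B' = add_entry k c 1 (add_entry (k + 1) c (- 1) B)"
      and ne: "G n i k B c \<noteq> (\<Sum>j=i..n. B k j)"
      using f f_op_column[OF 2 c] by (auto split: if_splits)
    have "G n i k C = G n i k B" "(\<Sum>j=i..n. C k j) = (\<Sum>j=i..n. B k j)"
      using k by (auto simp: C_def G_add_entry column_sum_add_entry)
    then have "f_op n i m k C = Some (add_entry k c 1 (add_entry (k + 1) c (- 1) C))"
      using f_op_column[OF 2, of n C c m] c ne by simp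
    moreover have "G n i 1 B' = G n i 1 B" "(\<Sum>j=i..n. B' 1 j) = (\<Sum>j=i..n. B 1 j)"
      using k by (auto simp: B' G_add_entry column_sum_add_entry)
    then have "f_op n i m 1 B' = (if G n i 1 B p = (\<Sum>j=i..n. B 1 j) then None
        else Some (add_entry 1 p 1 (add_entry 2 p (- 1) B')))"
      using f_op_column[OF i1, of n B' p m] p by (simp add: numeral_2_eq_2)
    moreover have "add_entry 1 p 1 (add_entry 2 p (- 1) B')
        = add_entry k c 1 (add_entry (k + 1) c (- 1) C)"
      by (intro ext) (simp add: B' C_def add_entry_apply)
    ultimately show ?thesis using f1 by auto
  next
    case 3
    obtain c where c: "first_max (F i k B) {1..i} c"
      using first_max_exists[of "{1..i}" "F i k B"] i by auto
    then have c': "1 \<le> c" "c \<le> i" by (auto simp: first_max_def)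
    have B': "B' = add_entry c (k - 1) (- 1) (add_entry c k 1 B)"
      and ne: "F i k B c \<noteq> (\<Sum>j=1..i. B j k)"
      using f f_op_row[OF 3 c, of n m] by (auto split: if_splits)
    have G': "G n i 1 B' t = G n i 1 B t - (if c = 1 \<and> t = k - 1 then 1 else 0)
        + (if c = 2 \<and> t = k then 1 else 0)" if "t \<in> {i..n}" for t
      using that 3 k c' by (auto simp: B' G_add_entry)
    have F': "F i k C t = F i k B t + (if p = k - 1 \<and> t = 1 then 1 else 0)
        - (if p = k \<and> t = 2 then 1 else 0)" if "t \<in> {1..i}" for t
      using that 3 k p' i1 by (auto simp: C_def F_add_entry)
    have sum_B': "(\<Sum>j=i..n. B' 1 j) = (\<Sum>j=i..n. B 1 j)"
      using 3 k by (auto simp: B' column_sum_add_entry)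
    have sum_C: "(\<Sum>j=1..i. C j k) = (\<Sum>j=1..i. B j k)"
      using i1 by (auto simp: C_def row_sum_add_entry)
    have krange: "i \<le> k - 1" "k - 1 \<le> n" "k - 1 < k" using 3 k by auto
    have minor: "F i k B 2 - F i k B 1 = G n i 1 B (k - 1) - G n i 1 B k"
      using F_Suc[of 1 i k B] G_Suc[of i "k - 1" n 1 B] 3 k i1 by (simp add: numeral_2_eq_2)
    have pm: "\<And>t. i \<le> t \<Longrightarrow> t \<le> n \<Longrightarrow> G n i 1 B t \<le> G n i 1 B p"
        "\<And>t. p < t \<Longrightarrow> t \<le> n \<Longrightarrow> G n i 1 B t < G n i 1 B p"
      using p by (auto simp: last_max_def)
    have cm: "\<And>t. 1 \<le> t \<Longrightarrow> t \<le> i \<Longrightarrow> F i k B t \<le> F i k B c"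
        "\<And>t. t < c \<Longrightarrow> 1 \<le> t \<Longrightarrow> F i k B t < F i k B c"
      using c by (auto simp: first_max_def)
    \<comment> \<open>Exactly here each operator moves the extreme maximizer of the other one.\<close>
    show ?thesis
    proof (cases "p = k - 1 \<and> c = 2 \<and> G n i 1 B k + 1 = G n i 1 B (k - 1)")
      case True
      have kp: "k = Suc p" "c = 2" using True k by auto
      have "last_max (G n i 1 B') {i..n} k"
        unfolding last_max_def using True pm G' 3 k by force
      then have "f_op n i m 1 B' = (if G n i 1 B p = (\<Sum>j=i..n. B 1 j) then None
          else Some (add_entry 1 k 1 (add_entry 2 k (- 1) B')))"
        using f_op_column[OF i1, of n B' k m] sum_B' G'[of k] True 3 k
        by (simp add: numeral_2_eq_2)
      moreover have "first_max (F i k C) {1..i} 1"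
        unfolding first_max_def using True cm F' minor i1 k by force
      then have "f_op n i m k C = Some (add_entry 1 (k - 1) (- 1) (add_entry 1 k 1 C))"
        using f_op_row[OF 3, of C 1 n m] sum_C F'[of 1] True minor ne i1 k by simp
      moreover have "add_entry 1 k 1 (add_entry 2 k (- 1) B')
          = add_entry 1 (k - 1) (- 1) (add_entry 1 k 1 C)"
        using kp by (intro ext) (simp add: B' C_def add_entry_apply)
      ultimately show ?thesis using f1 by auto
    next
      case no_switch: False
      have key: "c = 1 \<Longrightarrow> G n i 1 B k \<ge> G n i 1 B (k - 1)" "c = 2 \<Longrightarrow> G n i 1 B k < G n i 1 B (k - 1)"
        "p = k - 1 \<Longrightarrow> F i k B 1 < F i k B 2"
        using cm(1)[of 2] cm(2)[of 1] pm(2)[of k] minor i1 k by auto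
      have "G n i 1 B' p = G n i 1 B p"
        using G'[of p] key pm(2)[of k] pm(1)[of "k - 1"] krange p' k 3 by auto
      moreover have "G n i 1 B' t \<le> G n i 1 B p \<and> (p < t \<longrightarrow> G n i 1 B' t < G n i 1 B p)"
        if "t \<in> {i..n}" for t
        using G'[of t] that pm(1)[of t] pm(2)[of t] pm(1)[of "k - 1"] pm(2)[of "k - 1"] key
          no_switch krange k 3 by (cases "t = k"; cases "p < k - 1"; cases "p = k - 1") auto
      ultimately have "last_max (G n i 1 B') {i..n} p" "G n i 1 B' p = G n i 1 B p"
        using p' by (auto simp: last_max_def)
      then have "f_op n i m 1 B' = (if G n i 1 B p = (\<Sum>j=i..n. B 1 j) then None
          else Some (add_entry 1 p 1 (add_entry 2 p (- 1) B')))"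
        using f_op_column[OF i1, of n B' p m] sum_B' by (simp add: numeral_2_eq_2)
      moreover have "F i k C c = F i k B c"
        using F'[of c] key pm(2)[of k] pm(1)[of "k - 1"] krange c' k 3 by (cases "c = 1"; cases "c = 2") auto
      moreover have "F i k C t \<le> F i k B c \<and> (t < c \<longrightarrow> F i k C t < F i k B c)"
        if "t \<in> {1..i}" for t
        using F'[of t] that cm(1)[of t] cm(2)[of t] cm(1)[of 2] cm(2)[of 2] key minor
          no_switch k i1 by (cases "t = 1"; cases "c = 2"; cases "c = 1") auto
      ultimately have "first_max (F i k C) {1..i} c" "F i k C c = F i k B c"
        using c' by (auto simp: first_max_def)
      then have "f_op n i m k C = Some (add_entry c (k - 1) (- 1) (add_entry c k 1 C))"
        using f_op_row[OF 3, of C c n m] sum_C ne by simp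
      moreover have "add_entry 1 p 1 (add_entry 2 p (- 1) B')
          = add_entry c (k - 1) (- 1) (add_entry c k 1 C)"
        by (intro ext) (simp add: B' C_def add_entry_apply)
      ultimately show ?thesis
        using f1 \<open>f_op n i m 1 B' = _\<close> by auto
    qed
  qed
qed


section \<open>Highest weight arrays\<close>

text \<open>
  If \<open>\<epsilon>\<^sub>l\<close> vanishes then the maximum of \<open>F\<^sub>l\<close> is the total of row \<open>l - 1\<close>; comparing
  with an arbitrary value \<open>F\<^sub>l(p)\<close> gives a dominance condition between the two rows.
\<close>

lemma e_op_None_row:
  assumes "i < l" "e_op n i l A = None" "1 \<le> p" "p \<le> i"
  shows "(\<Sum>j=p..i. A j l) \<le> (\<Sum>j=p + 1..i. A j (l - 1))"
proof -
  obtain q where q: "last_max (F i l A) {1..i} q"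
    using last_max_exists[of "{1..i}" "F i l A"] assms by auto
  then have "F i l A p \<le> F i l A q" using assms by (auto simp: last_max_def)
  moreover have "F i l A q = (\<Sum>j=1..i. A j (l - 1))"
    using e_op_row[OF assms(1) q, of n] assms(2) by (auto split: if_splits)
  ultimately show ?thesis
    using sum_split_at(2)[of 1 p i "\<lambda>j. A j (l - 1)"] assms by (simp add: F_def)
qed

lemma e_op_None_column:
  assumes "l < i" "e_op n i l A = None" "i \<le> p" "p \<le> n"
  shows "(\<Sum>j=i..p. A l j) \<le> (\<Sum>j\<in>{i..<p}. A (l + 1) j)"
proof -
  obtain q where q: "first_max (G n i l A) {i..n} q"
    using first_max_exists[of "{i..n}" "G n i l A"] assms by auto
  then have "G n i l A p \<le> G n i l A q" using assms by (auto simp: first_max_def)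
  moreover have "G n i l A q = (\<Sum>j=i..n. A (l + 1) j)"
    using e_op_column[OF assms(1) q] assms(2) by (auto split: if_splits)
  ultimately show ?thesis
    using sum_split_at(1)[of i p n "A (l + 1)"] assms by (simp add: G_def)
qed

lemma e_op_None_node: "e_op n i i A = None \<Longrightarrow> A i i = 0"
  by (simp add: e_op_node split: if_splits)

lemma zero_of_sum_le_zero:
  fixes f :: "nat \<Rightarrow> int"
  assumes "sum f S \<le> 0" "finite S" "\<And>j. 0 \<le> f j" "j \<in> S"
  shows "f j = 0"
proof -
  have "sum f S = 0" using assms by (simp add: sum_nonneg order_antisym)
  then show ?thesis using assms by (simp add: sum_nonneg_eq_0_iff)
qed

text \<open>
  Vanishing spreads leftwards from column \<open>i\<close>. In column \<open>i\<close> itself the conditions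
  at \<open>i\<close> and at the rows below \<open>i\<close> remove all entries above row \<open>b\<close>; each further
  column is dominated by the entries of its right neighbour above row \<open>n\<close>. The cases
  \<open>(a,b) = (2,n)\<close> and \<open>(a,b) = (3,n+1)\<close> are the two families of highest weight arrays.
\<close>

lemma columns_vanish:
  assumes A: "A \<in> polytope n i m" and i: "1 \<le> i" "i \<le> n"
    and highest: "\<And>l. a \<le> l \<Longrightarrow> l < b \<Longrightarrow> e_op n i l A = None" and b: "n \<le> b"
    and p: "a \<le> p" "p \<le> i" and q: "q < b \<or> p < i"
  shows "A p q = 0"
proof -
  have "\<forall>q. q < b \<or> p < i \<longrightarrow> A p q = 0"
    using p(2,1)
  proof (induction p rule: inc_induct)
    case base
    show ?case
    proof (intro allI impI)
      fix q assume "q < b \<or> i < i"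
      then have q: "q < b" by simp
      consider "q < i" | "q = i" | "i < q" by linarith
      then show "A i q = 0"
      proof cases
        case 1
        then show ?thesis using polytope_outside[OF A, of i q] by simp
      next
        case 2
        then show ?thesis using e_op_None_node[of n i A] highest[of i] base q by simp
      next
        case 3
        then have "A i q \<le> 0"
          using e_op_None_row[OF 3 highest[of q], of i] base q i by simp
        then show ?thesis using polytope_nonneg[OF A, of i q] by simp
      qed
    qed
  next
    case (step p)
    have "e_op n i p A = None" using highest step.hyps step.prems b i by simp
    moreover have "A (p + 1) j = 0" if "j < n" for j using step that b by simp
    ultimately have "(\<Sum>j=i..n. A p j) \<le> 0"
      using e_op_None_column[OF step.hyps(2), of n A n] i by simp
    then have "A p q = 0" if "q \<in> {i..n}" for q
      by (rule zero_of_sum_le_zero) (use that polytope_nonneg[OF A] in auto)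
    then show ?case using polytope_outside[OF A, of p] by fastforce
  qed
  then show ?thesis using q by blast
qed

lemma row_vanishes:
  assumes A: "A \<in> polytope n i m" and q: "i < q" and highest: "e_op n i q A = None"
    and p: "1 \<le> p" "p \<le> i" and right: "\<And>j. p < j \<Longrightarrow> j \<le> i \<Longrightarrow> A j (q - 1) = 0"
  shows "A p q = 0"
proof -
  have "(\<Sum>j=p..i. A j q) \<le> 0"
    using e_op_None_row[OF q highest p] right by simp
  then show ?thesis
    by (rule zero_of_sum_le_zero) (use p polytope_nonneg[OF A] in auto)
qed

lemma inner_highest_weight_support:
  assumes A: "A \<in> polytope n i m" and i: "1 \<le> i" "i \<le> n"
    and highest: "\<And>l. 2 \<le> l \<Longrightarrow> l < n \<Longrightarrow> e_op n i l A = None"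
    and nz: "A p q \<noteq> 0"
  shows "p = 1 \<and> (q = i \<or> q = n) \<or> p = i \<and> q = n"
proof -
  have range: "1 \<le> p" "p \<le> i" "i \<le> q" "q \<le> n"
    using polytope_outside[OF A, of p q] nz by auto
  have columns: "A p' q' = 0" if "2 \<le> p'" "p' \<le> i" "q' < n \<or> p' < i" for p' q'
    using columns_vanish[OF A i highest _ that] by simp
  have "A 1 q' = 0" if "i < q'" "q' < n" for q'
  proof (rule row_vanishes[OF A that(1) highest])
    show "A j (q' - 1) = 0" if "1 < j" "j \<le> i" for j
      by (rule columns) (use that \<open>q' < n\<close> in auto)
  qed (use that i in auto)
  then have "q = i \<or> q = n" if "p = 1" using that nz range by (metis le_neq_implies_less)
  moreover have "p = i \<and> q = n" if "p \<noteq> 1"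
    using columns[of p q] that nz range by (auto simp: less_le)
  ultimately show ?thesis by blast
qed

text \<open>
  The columns from 3 on vanish by \<open>columns_vanish\<close>. Below row \<open>i\<close>, each row is dominated by
  the previous one shifted by one column, so column 2 vanishes there, and hence column 1
  vanishes below row \<open>i + 1\<close>. In row \<open>i + 1\<close> the entry of column 1 is bounded by
  \<open>a\<^bsub>2,i\<^esub>\<close> only.
\<close>

lemma upper_highest_weight_support:
  assumes B: "B \<in> polytope n i m" and i: "1 \<le> i" "i \<le> n"
    and highest: "\<And>l. 3 \<le> l \<Longrightarrow> l \<le> n \<Longrightarrow> e_op n i l B = None"
  shows "B p q \<noteq> 0 \<Longrightarrow> p = 1 \<and> (q = i \<or> q = i + 1) \<or> p = 2 \<and> q = i"
    and "2 \<le> i \<Longrightarrow> B 1 (i + 1) \<le> B 2 i"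
proof -
  have columns: "B p' q' = 0" if "3 \<le> p'" for p' q'
  proof (cases "p' \<le> i \<and> q' \<le> n")
    case True
    then show ?thesis using columns_vanish[OF B i, of 3 "n + 1" p' q'] highest that by simp
  next
    case False
    then show ?thesis using polytope_outside[OF B, of p' q'] by auto
  qed
  have second: "B 2 q' = 0" if "i < q'" for q'
  proof (cases "2 \<le> i \<and> q' \<le> n")
    case True
    then show ?thesis using row_vanishes[OF B that highest, of 2] that columns by simp
  next
    case False
    then show ?thesis using polytope_outside[OF B, of 2 q'] by auto
  qed
  have first: "B 1 q' = 0" if "i + 1 < q'" for q'
  proof (cases "q' \<le> n")
    case True
    have "B j (q' - 1) = 0" if "1 < j" for j
      using second[of "q' - 1"] columns[of j] \<open>i + 1 < q'\<close> that by (cases "j = 2") auto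
    then show ?thesis using row_vanishes[OF B _ highest, of q' 1] that i True by simp
  next
    case False
    then show ?thesis using polytope_outside[OF B, of 1 q'] by auto
  qed
  show "p = 1 \<and> (q = i \<or> q = i + 1) \<or> p = 2 \<and> q = i" if "B p q \<noteq> 0"
  proof -
    have range: "1 \<le> p" "i \<le> q" using polytope_outside[OF B, of p q] that by auto
    then consider "p = 1" | "p = 2" | "3 \<le> p" by linarith
    then show ?thesis
      using that range columns[of p q] second[of q] first[of q]
      by cases (auto simp: le_less)
  qed
  show "B 1 (i + 1) \<le> B 2 i" if "2 \<le> i"
  proof (cases "i + 1 \<le> n")
    case True
    have "(\<Sum>j=1..i. B j (i + 1)) \<le> (\<Sum>j=2..i. B j i)"
      using e_op_None_row[of i "i + 1" n B 1] highest[of "i + 1"] that True by (simp add: numeral_2_eq_2)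
    also have "\<dots> = (\<Sum>j=2..2. B j i)"
      using columns that by (intro sum.mono_neutral_right) auto
    finally have "(\<Sum>j=1..i. B j (i + 1)) \<le> B 2 i" by simp
    moreover have "B 1 (i + 1) \<le> (\<Sum>j=1..i. B j (i + 1))"
      using i polytope_nonneg[OF B] by (intro member_le_sum) auto
    ultimately show ?thesis by simp
  next
    case False
    then show ?thesis using polytope_outside[OF B, of 1 "i + 1"] polytope_nonneg[OF B, of 2 i] by simp
  qed
qed

text \<open>
  Together with the support condition these three numbers determine all three entries, so an
  array of this family is determined by its content.
\<close>

lemma upper_highest_weight_content:
  assumes B: "B \<in> polytope n i m" and i: "2 \<le> i" "i \<le> n"
    and highest: "\<And>l. 3 \<le> l \<Longrightarrow> l \<le> n \<Longrightarrow> e_op n i l B = None"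
  shows "content n i m B 1 = int m - B 1 i - B 1 (i + 1)"
    and "content n i m B 2 = int m - B 2 i"
    and "content n i m B (i + 1) = B 1 i + B 2 i"
proof -
  note support = upper_highest_weight_support(1)[OF B _ i(2) highest]
  have "(\<Sum>q=i..n. B 1 q) = (\<Sum>q\<in>{i, i + 1}. B 1 q)"
    using support[of 1] i polytope_outside[OF B, of 1 "i + 1"]
    by (intro sum.mono_neutral_cong) auto
  then show "content n i m B 1 = int m - B 1 i - B 1 (i + 1)"
    using i by (simp add: content_def)
  have "(\<Sum>q=i..n. B 2 q) = (\<Sum>q\<in>{i}. B 2 q)"
    using support[of 2] i by (intro sum.mono_neutral_cong) auto
  then show "content n i m B 2 = int m - B 2 i"
    using i by (simp add: content_def)
  have "(\<Sum>p=1..i. B p i) = (\<Sum>p\<in>{1, 2}. B p i)"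
    using support[of _ i] i by (intro sum.mono_neutral_cong) auto
  then show "content n i m B (i + 1) = B 1 i + B 2 i"
    using i by (simp add: content_def)
qed

lemma upper_highest_weight_eqI:
  assumes i: "1 \<le> i" "i \<le> n"
    and B: "\<And>p q. B p q \<noteq> 0 \<Longrightarrow> p = 1 \<and> (q = i \<or> q = i + 1) \<or> p = 2 \<and> q = i"
    and C: "\<And>p q. C p q \<noteq> 0 \<Longrightarrow> p = 1 \<and> (q = i \<or> q = i + 1) \<or> p = 2 \<and> q = i"
    and "B 1 i = C 1 i" "B 1 (i + 1) = C 1 (i + 1)" "B 2 i = C 2 i"
  shows "B = C"
proof (intro ext)
  show "B p q = C p q" for p q
    using B[of p q] C[of p q] assms(5-7) by metis
qed

text \<open>
  Here \<open>G\<^sub>1\<close> takes only two values: \<open>a\<^bsub>1,i\<^esub> + a\<^bsub>2,i\<^esub>\<close> at \<open>i\<close>, and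
  \<open>a\<^bsub>1,i\<^esub> + a\<^bsub>1,i+1\<^esub>\<close> everywhere after \<open>i\<close>. The second one is also the total of
  column 1, so \<open>\<phi>\<^sub>1 = a\<^bsub>2,i\<^esub> - a\<^bsub>1,i+1\<^esub>\<close>.
\<close>

lemma f_op_1_upper_highest_weight:
  assumes B: "B \<in> polytope n i m" and i: "2 \<le> i" "i \<le> n"
    and highest: "\<And>l. 3 \<le> l \<Longrightarrow> l \<le> n \<Longrightarrow> e_op n i l B = None"
  shows "f_op n i m 1 B = (if B 1 (i + 1) = B 2 i then None
    else Some (add_entry 1 i 1 (add_entry 2 i (- 1) B)))"
proof -
  note support = upper_highest_weight_support(1)[OF B _ i(2) highest]
  have le: "B 1 (i + 1) \<le> B 2 i"
    using upper_highest_weight_support(2)[OF B _ i(2) highest i(1)] i by simp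
  have i1: "1 < i" using i by simp
  have first: "(\<Sum>q=i..t. B 1 q) = B 1 i + B 1 (i + 1)" if "i < t" for t
  proof -
    have "(\<Sum>q=i..t. B 1 q) = (\<Sum>q\<in>{i, i + 1}. B 1 q)"
      using support[of 1] i that by (intro sum.mono_neutral_cong) auto
    then show ?thesis by simp
  qed
  have Gi: "G n i 1 B i = B 1 i + B 2 i"
  proof -
    have "(\<Sum>q=i..n. B 2 q) = (\<Sum>q\<in>{i}. B 2 q)"
      using support[of 2] i by (intro sum.mono_neutral_cong) auto
    then show ?thesis by (simp add: G_def numeral_2_eq_2)
  qed
  have Gt: "G n i 1 B t = B 1 i + B 1 (i + 1)" if "i < t" for t
  proof -
    have "(\<Sum>q=t..n. B 2 q) = 0"
      using support[of 2] that i by (intro sum.neutral) force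
    then show ?thesis using first[OF that] by (simp add: G_def numeral_2_eq_2)
  qed
  have total: "(\<Sum>q=i..n. B 1 q) = B 1 i + B 1 (i + 1)"
    using first[of n] polytope_outside[OF B, of 1 "i + 1"] i by (cases "i = n") auto
  obtain p where p: "last_max (G n i 1 B) {i..n} p"
    using last_max_exists[of "{i..n}" "G n i 1 B"] i by auto
  then have p': "i \<le> p" "G n i 1 B i \<le> G n i 1 B p" using i by (auto simp: last_max_def)
  then have val: "G n i 1 B p = B 1 i + B 2 i" using Gi Gt[of p] le by (cases "p = i") auto
  have "p = i" if "B 1 (i + 1) \<noteq> B 2 i"
    using that val Gt[of p] p' le by (cases "p = i") auto
  then show ?thesis
    using f_op_column[OF i1 p, of m] val total by (auto simp: numeral_2_eq_2)
qed

section \<open>Promotion and the affine operators\<close>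

lemma content_add_corner:
  assumes "1 \<le> i" "i \<le> n" "1 \<le> j"
  shows "content n i m (add_entry 1 n d A) j
    = content n i m A j - (if j = 1 then d else 0) + (if j = n + 1 then d else 0)"
  using assms by (auto simp: content_def column_sum_add_entry row_sum_add_entry)

text \<open>
  The array \<open>A\<close> lives on \<open>(1,i)\<close>, \<open>(1,n)\<close>, \<open>(i,n)\<close>. For \<open>i > 1\<close> its content at
  \<open>n + 1\<close> is \<open>a\<^bsub>1,n\<^esub> + a\<^bsub>i,n\<^esub>\<close> and its content at \<open>i\<close> is
  \<open>m - a\<^bsub>i,n\<^esub>\<close>. Their sum minus \<open>m\<close> is \<open>a\<^bsub>1,n\<^esub>\<close>, and for \<open>pr A\<close> the rotated content
  gives \<open>\<phi>\<^sub>1\<close> by the same expression. For \<open>i = 1\<close> both numbers are a single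
  content entry. When they are positive, \<open>f\<^sub>1 (pr A)\<close> and \<open>pr (f\<^sub>0 A)\<close> are compared
  cell by cell through their contents.
\<close>

lemma promotion_f0_highest_weight:
  assumes i: "1 \<le> i" "i \<le> n" and pr: "is_promotion n i m pr"
    and A: "A \<in> polytope n i m"
    and highest: "\<And>l. 2 \<le> l \<Longrightarrow> l < n \<Longrightarrow> e_op n i l A = None"
  shows "f_op n i m 1 (pr A) = map_option pr (f0 n A)"
proof -
  have pr_polytope: "pr X \<in> polytope n i m" if "X \<in> polytope n i m" for X
    using pr that by (auto simp: is_promotion_def bij_betw_def)
  have pr_e: "e_op n i (l + 1) (pr X) = map_option pr (e_op n i l X)"
    if "X \<in> polytope n i m" "1 \<le> l" "l + 1 \<le> n" for X l
    using pr that by (simp add: is_promotion_def)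
  have pr_content: "content n i m (pr X) 1 = content n i m X (n + 1)"
    "\<And>j. 1 \<le> j \<Longrightarrow> j \<le> n \<Longrightarrow> content n i m (pr X) (j + 1) = content n i m X j"
    if "X \<in> polytope n i m" for X
    using pr that by (auto simp: is_promotion_def)
  have pr_highest: "e_op n i l (pr X) = None"
    if "X \<in> polytope n i m" "\<And>l. 2 \<le> l \<Longrightarrow> l < n \<Longrightarrow> e_op n i l X = None" "3 \<le> l" "l \<le> n" for X l
    using pr_e[OF that(1), of "l - 1"] that by simp
  let ?B = "pr A" and ?A' = "add_entry 1 n (- 1) A"
  let ?C = "pr ?A'"
  note B = pr_polytope[OF A] and B_highest = pr_highest[OF A highest]
  have support: "X p q = 0" if "X = A" "2 \<le> p" "p < i \<or> q < n" for X p q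
    using inner_highest_weight_support[OF A i highest, of p q] that by auto
  have phi: "f_op n i m 1 ?B = None \<longleftrightarrow> A 1 n = 0"
  proof (cases "i = 1")
    case True
    have "int m - (\<Sum>q=1..n. ?B 1 q) = A 1 n"
      using pr_content(1)[OF A] True i by (simp add: content_def)
    then show ?thesis using f_op_node[of n 1 m ?B] True by auto
  next
    case False
    then have i2: "2 \<le> i" using i by simp
    have "(\<Sum>p=1..i. A p n) = (\<Sum>p\<in>{1, i}. A p n)"
      using support i by (intro sum.mono_neutral_cong) auto
    moreover have "(\<Sum>q=i..n. A i q) = (\<Sum>q\<in>{n}. A i q)"
      using support i i2 by (intro sum.mono_neutral_cong) auto
    ultimately have "?B 2 i - ?B 1 (i + 1) = A 1 n"
      using upper_highest_weight_content(1,3)[OF B i2 i(2) B_highest]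
        pr_content(1)[OF A] pr_content(2)[OF A i] i2 i by (simp add: content_def)
    then show ?thesis
      using f_op_1_upper_highest_weight[OF B i2 i(2) B_highest] by auto
  qed
  show ?thesis
  proof (cases "A 1 n = 0")
    case True
    then show ?thesis using phi by (simp add: f0_def phi0_def)
  next
    case False
    then have A': "?A' \<in> polytope n i m"
      using polytope_decrease[OF A, of 1 n] polytope_nonneg[OF A, of 1 n] by simp
    have A'_highest: "e_op n i l ?A' = None" if "2 \<le> l" "l < n" for l
      using e_op_add_corner[OF that] highest[OF that] by simp
    note C = pr_polytope[OF A'] and C_highest = pr_highest[OF A' A'_highest]
    have shift: "content n i m ?C 1 = content n i m ?B 1 - 1"
      "content n i m ?C 2 = content n i m ?B 2 + 1"
      "\<And>j. 2 \<le> j \<Longrightarrow> j \<le> n \<Longrightarrow> content n i m ?C (j + 1) = content n i m ?B (j + 1)"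
      using pr_content[OF A] pr_content[OF A'] content_add_corner[of i n _ m "- 1" A] i
        pr_content(2)[OF A, of 1] pr_content(2)[OF A', of 1]
      by (auto simp: numeral_2_eq_2)
    note B_support = upper_highest_weight_support(1)[OF B i B_highest]
    note C_support = upper_highest_weight_support(1)[OF C i C_highest]
    have "f_op n i m 1 ?B = Some ?C"
    proof (cases "i = 1")
      case True
      have "f_op n i m 1 ?B = Some (add_entry 1 1 1 ?B)"
        using phi False f_op_node[of n 1 m ?B] True by (auto split: if_splits)
      moreover have "add_entry 1 1 1 ?B = ?C"
      proof (rule upper_highest_weight_eqI[OF i _ C_support])
        show "p = 1 \<and> (q = i \<or> q = i + 1) \<or> p = 2 \<and> q = i" if "add_entry 1 1 1 ?B p q \<noteq> 0" for p q
          using that B_support[of p q] True by (auto simp: add_entry_apply split: if_splits)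
        have two: "(\<Sum>q=1..n. X 1 q) = X 1 1 + X 1 2"
          if "X \<in> polytope n i m" "\<And>p q. X p q \<noteq> 0 \<Longrightarrow> p = 1 \<and> (q = i \<or> q = i + 1) \<or> p = 2 \<and> q = i" for X
        proof -
          have "(\<Sum>q=1..n. X 1 q) = (\<Sum>q\<in>{1, 2}. X 1 q)"
            using that(2)[of 1] polytope_outside[OF that(1), of 1 2] True i
            by (intro sum.mono_neutral_cong) (auto simp: numeral_2_eq_2)
          then show ?thesis by simp
        qed
        have "?C 1 1 = ?B 1 1 + 1" "?C 1 2 = ?B 1 2"
          using shift(1,2) two[OF B B_support] two[OF C C_support] True by (auto simp: content_def)
        then show "add_entry 1 1 1 ?B 1 i = ?C 1 i" "add_entry 1 1 1 ?B 1 (i + 1) = ?C 1 (i + 1)"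
          using True by (simp_all add: add_entry_apply numeral_2_eq_2)
        show "add_entry 1 1 1 ?B 2 i = ?C 2 i"
          using polytope_outside[OF B, of 2 i] polytope_outside[OF C, of 2 i] True
          by (simp add: add_entry_apply)
      qed
      ultimately show ?thesis by simp
    next
      case False
      then have i2: "2 \<le> i" using i by simp
      have "f_op n i m 1 ?B = Some (add_entry 1 i 1 (add_entry 2 i (- 1) ?B))"
        using phi \<open>A 1 n \<noteq> 0\<close> f_op_1_upper_highest_weight[OF B i2 i(2) B_highest]
        by (auto split: if_splits)
      moreover have "add_entry 1 i 1 (add_entry 2 i (- 1) ?B) = ?C"
      proof (rule upper_highest_weight_eqI[OF i _ C_support])
        show "p = 1 \<and> (q = i \<or> q = i + 1) \<or> p = 2 \<and> q = i"
          if "add_entry 1 i 1 (add_entry 2 i (- 1) ?B) p q \<noteq> 0" for p q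
          using that B_support[of p q] by (auto simp: add_entry_apply split: if_splits)
        have "?C 2 i = ?B 2 i - 1" "?C 1 i = ?B 1 i + 1" "?C 1 (i + 1) = ?B 1 (i + 1)"
          using upper_highest_weight_content[OF B i2 i(2) B_highest]
            upper_highest_weight_content[OF C i2 i(2) C_highest]
            shift(1,2) shift(3)[OF i2 i(2)] by auto
        then show "add_entry 1 i 1 (add_entry 2 i (- 1) ?B) 1 i = ?C 1 i"
          "add_entry 1 i 1 (add_entry 2 i (- 1) ?B) 1 (i + 1) = ?C 1 (i + 1)"
          "add_entry 1 i 1 (add_entry 2 i (- 1) ?B) 2 i = ?C 2 i"
          by (simp_all add: add_entry_apply)
      qed
      ultimately show ?thesis by simp
    qed
    then show ?thesis using False by (simp add: f0_def phi0_def)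
  qed
qed

lemma promotion_f0:
  assumes i: "1 \<le> i" "i \<le> n" and pr: "is_promotion n i m pr"
    and A: "A \<in> polytope n i m"
  shows "f_op n i m 1 (pr A) = map_option pr (f0 n A)"
  using A
proof (induction "nat (level n i A)" arbitrary: A rule: less_induct)
  case less
  note A = less.prems
  show ?case
  proof (cases "\<forall>l. 2 \<le> l \<and> l < n \<longrightarrow> e_op n i l A = None")
    case True
    then show ?thesis using promotion_f0_highest_weight[OF i pr A] by blast
  next
    case False
    then obtain l A' where l: "2 \<le> l" "l < n" and e: "e_op n i l A = Some A'" by auto
    have A': "A' \<in> polytope n i m" using e_op_polytope[OF A i _ _ e] l by simp
    have f: "f_op n i m l A' = Some A" by (rule f_op_e_op[OF A i e])
    have pr_f: "f_op n i m (l + 1) (pr X) = map_option pr (f_op n i m l X)"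
      if "X \<in> polytope n i m" for X
      using pr that l by (simp add: is_promotion_def)
    have "level n i A' = level n i A - 1" using level_e_op[OF i _ _ e] l by simp
    then have "nat (level n i A') < nat (level n i A)" using level_nonneg[OF A'] by simp
    then have IH: "f_op n i m 1 (pr A') = map_option pr (f0 n A')"
      using less.hyps A' by blast
    have "f_op n i m 1 (pr A)
        = Option.bind (map_option pr (f0 n A')) (f_op n i m (l + 1))"
      using f_op_1_commute[OF i, of "l + 1" m "pr A'" "pr A"] pr_f[OF A'] f l IH by simp
    also have "\<dots> = map_option pr (f0 n A)"
    proof (cases "A' 1 n = 0")
      case True
      then show ?thesis using f_op_corner_entry[OF l f] by (simp add: f0_def phi0_def)
    next
      case False
      then have "add_entry 1 n (- 1) A' \<in> polytope n i m"
        using polytope_decrease[OF A', of 1 n] polytope_nonneg[OF A', of 1 n] by simp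
      then show ?thesis
        using pr_f f_op_add_corner[OF l, of i m "- 1" A'] f_op_corner_entry[OF l f] False f
        by (simp add: f0_def phi0_def)
    qed
    finally show ?thesis .
  qed
qed


theorem corollary3p1:
  fixes n i m :: nat and pr :: "array \<Rightarrow> array"
  assumes "1 \<le> i" and "i \<le> n" and "1 \<le> m"
    and "is_promotion n i m pr"
  shows "\<forall>A\<in>polytope n i m.
           affine_f0 n i m pr A = f0 n A \<and> affine_e0 n i m pr A = e0 n i m A"
proof
  fix A assume A: "A \<in> polytope n i m"
  note i = assms(1,2)
  let ?P = "polytope n i m"
  have pr: "pr X \<in> ?P" "inv_into ?P pr (pr X) = X" if "X \<in> ?P" for X
    using assms(4) that by (auto simp: is_promotion_def bij_betw_def)
  have surj: "\<exists>X\<in>?P. pr X = Y" if "Y \<in> ?P" for Y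
    using assms(4) that unfolding is_promotion_def bij_betw_def by (metis imageE)
  note pr_f0 = promotion_f0[OF i assms(4)]
  have f0_polytope: "X \<in> ?P" if "f0 n A = Some X" for X
    using that polytope_decrease[OF A, of 1 n] polytope_nonneg[OF A, of 1 n]
    by (auto simp: f0_def phi0_def split: if_splits)
  have "affine_f0 n i m pr A = f0 n A"
    using pr_f0[OF A] pr(2) f0_polytope by (cases "f0 n A") (auto simp: affine_f0_def)
  moreover have "affine_e0 n i m pr A = e0 n i m A"
  proof (cases "e_op n i 1 (pr A)")
    case None
    have "eps0 n i m A = 0"
    proof (rule ccontr)
      let ?A' = "add_entry 1 n 1 A"
      assume "eps0 n i m A \<noteq> 0"
      then have A': "?A' \<in> ?P"
        using polytope_increase_corner[OF A i] eps0_nonneg[OF A i] by simp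
      have "f0 n ?A' = Some A"
        using polytope_nonneg[OF A, of 1 n]
        by (simp add: f0_def phi0_def add_entry_apply add_entry_cancel)
      then have "f_op n i m 1 (pr ?A') = Some (pr A)" using pr_f0[OF A'] by simp
      then show False using e_op_f_op[OF pr(1)[OF A'] i] None by simp
    qed
    then show ?thesis using None by (simp add: affine_e0_def e0_def)
  next
    case (Some B)
    have "B \<in> ?P" using e_op_polytope[OF pr(1)[OF A] i _ _ Some] i by simp
    then obtain A' where A': "A' \<in> ?P" "pr A' = B" using surj by blast
    have "f_op n i m 1 B = Some (pr A)" by (rule f_op_e_op[OF pr(1)[OF A] i Some])
    then obtain A'' where "f0 n A' = Some A''" "pr A'' = pr A"
      using pr_f0[OF A'(1)] A'(2) by (cases "f0 n A'") auto
    moreover from this have "A'' \<in> ?P"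
      using polytope_decrease[OF A'(1), of 1 n] polytope_nonneg[OF A'(1), of 1 n]
      by (auto simp: f0_def phi0_def split: if_splits)
    ultimately have "f0 n A' = Some A" using pr(2) A by metis
    then have AA': "A = add_entry 1 n (- 1) A'" by (simp add: f0_def phi0_def split: if_splits)
    then have "A' = add_entry 1 n 1 A" by (simp add: add_entry_cancel)
    moreover have "eps0 n i m A > 0"
      using eps0_nonneg[OF A'(1) i] i AA'
      by (simp add: eps0_def row_sum_add_entry column_sum_add_entry)
    ultimately show ?thesis
      using Some pr(2)[OF A'(1)] A'(2) by (simp add: affine_e0_def e0_def)
  qed
  ultimately show "affine_f0 n i m pr A = f0 n A \<and> affine_e0 n i m pr A = e0 n i m A" ..
qed

end
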